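(* Let $n\ge 1$, $K=\mathbb{Q}(T_1,\dots,T_n)$, and let $E/K$ be an elliptic curve $Y^2=X^3+A(\mathbf T)X+B(\mathbf T)$ with $A,B\in\mathbb{Z}[\mathbf T]$, such that there is no nonconstant $g\in\mathbb{Q}[\mathbf T]$ with $A/g^4,\,B/g^6\in\mathbb{Z}[\mathbf T]$, and such that $E$ is not split over $K$. Let $\Delta_E(\mathbf T)=-16(4A(\mathbf T)^3+27B(\mathbf T)^2)$. For $P\in E(K)$ and a real number $B>1$ put $$\mathbb{Q}^n_B(\Delta_E,P)=\{\omega\in\mathbb{Q}^n \mid 1<H(\omega)\le B,\ \Delta_E(\omega)\ne 0,\ P_\omega\text{ is defined}\}.$$ Then for every $P\in E(K)$ there exists a constant $U_P$, depending only on $P$ (a point of the given curve $E$), such that $$\hat h_{E_\omega}(P_\omega)\le U_P\,(1+h(\omega))$$ for all $B>1$ and all $\omega\in\mathbb{Q}^n_B(\Delta_E,P)$. Consequently, $$\limsup_{B\to\infty}\ \frac{1}{\#\mathbb{Q}^n_B(\Delta_E,P)}\sum_{\omega\in\mathbb{Q}^n_B(\Delta_E,P)}\frac{\hat h_{E_\omega}(P_\omega)}{h(\omega)}<\infty .$$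
   Context: Notation: $\mathbf T=(T_1,\dots,T_n)$. (The letter $B$ denotes both the polynomial $B(\mathbf T)$ and, as a real number, the height bound.) "$E$ is not split over $K$" means that $E$ is not $K$-birationally isomorphic to $E_0\times_{\mathbb{Q}}K$ for any elliptic curve $E_0/\mathbb{Q}$. For $\omega\in\mathbb{Q}^n$ with $\Delta_E(\omega)\neq0$, $E_\omega/\mathbb{Q}$ is the elliptic curve $Y^2=X^3+A(\omega)X+B(\omega)$. For $P\in E(K)$, $P_\omega=P(\omega)\in E_\omega(\mathbb{Q})$ is the specialization of $P$ at $\omega$ (evaluate the coordinates of $P$ at $\omega$), whenever it is defined. Heights: for $\nu_0,\dots,\nu_n\in\mathbb{Z}$ with $\gcd(\nu_0,\dots,\nu_n)=1$, $H([\nu_0,\dots,\nu_n])=\max_i|\nu_i|$. For $\omega=(\omega_1,\dots,\omega_n)\in\mathbb{Q}^n$, $H(\omega)=H([1,\omega_1,\dots,\omega_n])$ and $h(\omega)=\log H(\omega)$. $\hat h_{E_\omega}$ is the canonical height on $E_\omega(\mathbb{Q})$, $\hat h_{E_\omega}(p)=\lim_{m\to\infty}4^{-m}h([x([2^m]p),1])$, where $h=\log H$ on $\mathbb{P}^1(\mathbb{Q})$ and the identity $O$ is assigned height $0$. *)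

theory Defs
  imports
    "HOL-Analysis.Analysis"
    "HOL-Library.Poly_Mapping"
    "HOL-Computational_Algebra.Polynomial_Factorial"
begin

text \<open>
  Polynomials in the variables \<open>T\<^sub>i\<close> for \<open>i :: 'n\<close>; a monomial is its exponent function
  \<open>'n \<Rightarrow>\<^sub>0 nat\<close>. The linear order on \<open>'n\<close> is only used by the library to see that the
  polynomials form an integral domain, so that \<open>'n ratfun\<close> is the field of rational functions.
\<close>

type_synonym ('n, 'c) mpoly = "('n \<Rightarrow>\<^sub>0 nat) \<Rightarrow>\<^sub>0 'c"

type_synonym 'n ratfun = "('n, rat) mpoly fract"

definition eval_mpoly :: "('n::finite, rat) mpoly \<Rightarrow> rat ^ 'n \<Rightarrow> rat" where
  "eval_mpoly p \<omega> =
     (\<Sum>m\<in>Poly_Mapping.keys p. Poly_Mapping.lookup p m * (\<Prod>i\<in>UNIV. (\<omega> $ i) ^ Poly_Mapping.lookup m i))"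

definition const_mpoly :: "rat \<Rightarrow> ('n, rat) mpoly" where
  "const_mpoly c = Poly_Mapping.single 0 c"

definition rat_mpoly :: "('n, int) mpoly \<Rightarrow> ('n, rat) mpoly" where
  "rat_mpoly p = Poly_Mapping.map rat_of_int p"

definition int_polys :: "'n::{finite, linorder} ratfun set" where
  "int_polys = range (\<lambda>p. to_fract (rat_mpoly p))"


text \<open>The curve \<open>Y\<^sup>2 = X\<^sup>3 + a X + b\<close>; it is an elliptic curve iff its discriminant is nonzero.\<close>

datatype 'a weierstrass = Weierstrass (coeff_a: 'a) (coeff_b: 'a)

definition discriminant :: "'a::comm_ring_1 weierstrass \<Rightarrow> 'a" where
  "discriminant E = -16 * (4 * coeff_a E ^ 3 + 27 * coeff_b E ^ 2)"

datatype 'a point = Infinity | Affine 'a 'a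

definition curve_points :: "'a::comm_ring_1 weierstrass \<Rightarrow> 'a point set" where
  "curve_points E =
     insert Infinity {Affine x y | x y. y ^ 2 = x ^ 3 + coeff_a E * x + coeff_b E}"

text \<open>
  Chord-and-tangent addition. On the curve, \<open>x\<^sub>1 = x\<^sub>2\<close> and \<open>y\<^sub>1 \<noteq> - y\<^sub>2\<close> force the two points
  to coincide, which is the tangent case.
\<close>

fun point_add :: "'a::field weierstrass \<Rightarrow> 'a point \<Rightarrow> 'a point \<Rightarrow> 'a point" where
  "point_add E Infinity q = q"
| "point_add E p Infinity = p"
| "point_add E (Affine x\<^sub>1 y\<^sub>1) (Affine x\<^sub>2 y\<^sub>2) =
     (if x\<^sub>1 = x\<^sub>2 \<and> y\<^sub>1 = - y\<^sub>2 then Infinity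
      else
        let l = (if x\<^sub>1 = x\<^sub>2 then (3 * x\<^sub>1 ^ 2 + coeff_a E) / (2 * y\<^sub>1)
                 else (y\<^sub>2 - y\<^sub>1) / (x\<^sub>2 - x\<^sub>1));
            x\<^sub>3 = l ^ 2 - x\<^sub>1 - x\<^sub>2
        in Affine x\<^sub>3 (l * (x\<^sub>1 - x\<^sub>3) - y\<^sub>1))"

text \<open>
  The multiple \<open>[k] p\<close>. The group law is associative, so the bracketing is immaterial;
  here the sum is bracketed by repeated doubling.
\<close>

fun point_mult :: "'a::field weierstrass \<Rightarrow> nat \<Rightarrow> 'a point \<Rightarrow> 'a point" where
  "point_mult E k p =
     (if k = 0 then Infinity
      else if even k then point_add E (point_mult E (k div 2) p) (point_mult E (k div 2) p)
      else point_add E p (point_mult E (k - 1) p))"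

declare point_mult.simps [simp del]


text \<open>
  The function field of \<open>Y\<^sup>2 = f(X)\<close> with \<open>f = X\<^sup>3 + a X + b\<close> over a field \<open>k\<close> is
  \<open>k(X) \<oplus> k(X) Y\<close>; the pair \<open>(r, s)\<close> stands for \<open>r + s Y\<close>, so addition is componentwise and
  multiplication uses \<open>Y\<^sup>2 = f(X)\<close>. Two curves are birationally isomorphic over \<open>k\<close> iff their
  function fields are isomorphic as extensions of \<open>k\<close>.
\<close>

type_synonym 'a funfield = "'a poly fract \<times> 'a poly fract"

definition ff_add :: "'a::field funfield \<Rightarrow> 'a funfield \<Rightarrow> 'a funfield" where
  "ff_add u v = (fst u + fst v, snd u + snd v)"

definition ff_mult :: "'a::field weierstrass \<Rightarrow> 'a funfield \<Rightarrow> 'a funfield \<Rightarrow> 'a funfield" where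
  "ff_mult E u v =
     (fst u * fst v + snd u * snd v * to_fract [:coeff_b E, coeff_a E, 0, 1:],
      fst u * snd v + snd u * fst v)"

definition ff_const :: "'a::field \<Rightarrow> 'a funfield" where
  "ff_const c = (to_fract [:c:], 0)"

definition birationally_isomorphic :: "'a::field weierstrass \<Rightarrow> 'a weierstrass \<Rightarrow> bool" where
  "birationally_isomorphic E E' \<longleftrightarrow>
     (\<exists>\<phi>. bij \<phi> \<and>
          (\<forall>u v. \<phi> (ff_add u v) = ff_add (\<phi> u) (\<phi> v)) \<and>
          (\<forall>u v. \<phi> (ff_mult E u v) = ff_mult E' (\<phi> u) (\<phi> v)) \<and>
          (\<forall>c. \<phi> (ff_const c) = ff_const c))"

definition base_change :: "rat weierstrass \<Rightarrow> 'n::{finite, linorder} ratfun weierstrass" where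
  "base_change E = map_weierstrass (\<lambda>c. to_fract (const_mpoly c)) E"

definition split_curve :: "'n::{finite, linorder} ratfun weierstrass \<Rightarrow> bool" where
  "split_curve E \<longleftrightarrow>
     (\<exists>E\<^sub>0 :: rat weierstrass. discriminant E\<^sub>0 \<noteq> 0 \<and> birationally_isomorphic E (base_change E\<^sub>0))"


definition generic_curve ::
    "('n::{finite, linorder}, int) mpoly weierstrass \<Rightarrow> 'n ratfun weierstrass" where
  "generic_curve E = map_weierstrass (\<lambda>p. to_fract (rat_mpoly p)) E"

definition special_curve ::
    "('n::{finite, linorder}, int) mpoly weierstrass \<Rightarrow> (rat, 'n) vec \<Rightarrow> rat weierstrass" where
  "special_curve E \<omega> = map_weierstrass (\<lambda>p. eval_mpoly (rat_mpoly p) \<omega>) E"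

text \<open>
  \<open>[X : Y : Z]\<close> are homogeneous coordinates of \<open>P\<close> in the projective plane over the field of
  rational functions, cleared of denominators. They can be evaluated at \<open>\<omega>\<close> iff they do not all
  vanish there; \<open>P\<close> can be specialized at \<open>\<omega>\<close> iff some choice of coordinates has this property.
\<close>

definition homogeneous_coords :: "'n::{finite, linorder} ratfun point \<Rightarrow>
    ('n, rat) mpoly \<Rightarrow> ('n, rat) mpoly \<Rightarrow> ('n, rat) mpoly \<Rightarrow> bool" where
  "homogeneous_coords P X Y Z \<longleftrightarrow>
     (case P of
        Infinity \<Rightarrow> X = 0 \<and> Y \<noteq> 0 \<and> Z = 0
      | Affine x y \<Rightarrow> Z \<noteq> 0 \<and> x = to_fract X / to_fract Z \<and> y = to_fract Y / to_fract Z)"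

text \<open>
  For \<open>P\<close> on the curve, \<open>Z(\<omega>) = 0\<close> implies \<open>X(\<omega>) = 0\<close> by the homogeneous equation
  \<open>Y\<^sup>2 Z = X\<^sup>3 + a X Z\<^sup>2 + b Z\<^sup>3\<close>, so the value is then \<open>[0 : 1 : 0]\<close>.
\<close>

definition specializes_to ::
    "'n::{finite, linorder} ratfun point \<Rightarrow> (rat, 'n) vec \<Rightarrow> rat point \<Rightarrow> bool" where
  "specializes_to P \<omega> p \<longleftrightarrow>
     (\<exists>X Y Z. homogeneous_coords P X Y Z \<and>
        (eval_mpoly X \<omega> \<noteq> 0 \<or> eval_mpoly Y \<omega> \<noteq> 0 \<or> eval_mpoly Z \<omega> \<noteq> 0) \<and>
        p = (if eval_mpoly Z \<omega> = 0 then Infinity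
             else Affine (eval_mpoly X \<omega> / eval_mpoly Z \<omega>) (eval_mpoly Y \<omega> / eval_mpoly Z \<omega>)))"

definition specialization_defined :: "'n::{finite, linorder} ratfun point \<Rightarrow> (rat, 'n) vec \<Rightarrow> bool" where
  "specialization_defined P \<omega> \<longleftrightarrow> (\<exists>p. specializes_to P \<omega> p)"

definition specialize :: "'n::{finite, linorder} ratfun point \<Rightarrow> (rat, 'n) vec \<Rightarrow> rat point" where
  "specialize P \<omega> = (THE p. specializes_to P \<omega> p)"


text \<open>
  Height of the projective point with homogeneous coordinates \<open>x \<noteq> 0\<close>: rescale to coprime
  integers \<open>\<nu>\<close>, which are unique up to a common sign.
\<close>

definition proj_height :: "rat ^ 'i::finite \<Rightarrow> real" where
  "proj_height x =
     (THE H. \<exists>c \<nu>. c \<noteq> 0 \<and> (\<forall>i. x $ i = c * rat_of_int (\<nu> i)) \<and>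
        Gcd (range \<nu>) = 1 \<and> H = real_of_int (Max (range (\<lambda>i. \<bar>\<nu> i\<bar>))))"

definition affine_height :: "rat ^ 'n::finite \<Rightarrow> real" where
  "affine_height \<omega> =
     proj_height (\<chi> i :: 'n option. case i of None \<Rightarrow> 1 | Some j \<Rightarrow> \<omega> $ j)"

definition log_height :: "rat ^ 'n::finite \<Rightarrow> real" where
  "log_height \<omega> = ln (affine_height \<omega>)"

fun x_height :: "rat point \<Rightarrow> real" where
  "x_height Infinity = 0"
| "x_height (Affine x y) = ln (proj_height (vector [x, 1] :: rat ^ 2))"

definition canonical_height :: "rat weierstrass \<Rightarrow> rat point \<Rightarrow> real" where
  "canonical_height E p = lim (\<lambda>m. x_height (point_mult E (2 ^ m) p) / 4 ^ m)"

definition good_params :: "('n::{finite, linorder}, int) mpoly weierstrass \<Rightarrow>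
    'n ratfun point \<Rightarrow> real \<Rightarrow> (rat, 'n) vec set" where
  "good_params E P B =
     {\<omega>. 1 < affine_height \<omega> \<and> affine_height \<omega> \<le> B \<and>
         eval_mpoly (rat_mpoly (discriminant E)) \<omega> \<noteq> 0 \<and> specialization_defined P \<omega>}"

end

(*
  The addition formulas give h(x(2p)) <= 4 h(x(p)) + O(1 + h(a, b)) on Y^2 = X^3 + a X + b, with an
  absolute constant; telescoping yields hhat(p) <= h(x(p)) + O(1 + h(a, b)). For a = A(omega) and
  b = B(omega) the error is O(1 + h(omega)), and so is h(x(P_omega)), because x(P_omega) is the
  quotient of two polynomial expressions in omega. The bound on the averages follows since
  h(omega) >= log 2 as soon as H(omega) > 1.
*)

theory Submission
  imports Defs
begin

text \<open>Every estimate is an upper bound, and an upper bound for a height can be read off from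
  any integer coordinates, because cancelling a common factor only lowers it. So no gcd has to be
  controlled: it suffices to clear denominators explicitly and to track how the resulting integers
  grow with \<open>H\<close>. The delicate point is \<open>x(P_omega)\<close>. The coordinates of
  \<open>P\<close> that can be evaluated may change with \<open>omega\<close>, so one quotient of
  polynomials need not describe \<open>x(P_omega)\<close> everywhere, and constants taken from
  varying coordinates would not be uniform. One fixed pair \<open>X\<close>, \<open>Z\<close> is
  therefore kept; where it degenerates to 0/0, the value is recovered as a limit along a line. The
  quotients of Taylor coefficients that arise are finitely many, with numerators and denominators
  again polynomial in \<open>omega\<close>.\<close>

subsection \<open>Heights in projective space\<close>

text \<open>Writing \<open>c / c'\<close> as \<open>p / q\<close> in lowest terms gives
  \<open>p * \<nu> i = q * \<nu>' i\<close>, so \<open>q\<close> divides every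
  \<open>\<nu> i\<close> and \<open>p\<close> every \<open>\<nu>' i\<close>; primitivity makes both
  units. This gives the definite description in \<open>proj_height\<close> its meaning.\<close>

lemma primitive_coords_unique:
  fixes \<nu> \<nu>' :: "'i \<Rightarrow> int"
  assumes "c \<noteq> 0" "c' \<noteq> 0" "\<And>i. c * rat_of_int (\<nu> i) = c' * rat_of_int (\<nu>' i)"
    and gcd: "Gcd (range \<nu>) = 1" and gcd': "Gcd (range \<nu>') = 1"
  shows "\<bar>\<nu> i\<bar> = \<bar>\<nu>' i\<bar>"
proof -
  obtain p q where pq: "quotient_of (c / c') = (p, q)" by force
  have q: "q > 0" and cop: "coprime p q" and c: "c / c' = of_int p / of_int q"
    using pq quotient_of_denom_pos quotient_of_coprime quotient_of_div by blast+
  have eq: "p * \<nu> j = q * \<nu>' j" for j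
  proof -
    have "of_int (p * \<nu> j) = (of_int (q * \<nu>' j) :: rat)"
    proof -
      have "c * of_int q = c' * of_int p" using c q assms(1,2) by (simp add: field_simps)
      then have "c' * (of_int p * of_int (\<nu> j)) = of_int q * (c * of_int (\<nu> j))"
        by (metis mult.assoc mult.commute)
      also have "\<dots> = c' * (of_int q * of_int (\<nu>' j))" using assms(3)[of j] by simp
      finally show ?thesis using assms(2) by simp
    qed
    then show ?thesis by (simp only: of_int_eq_iff)
  qed
  have "q dvd \<nu> j" for j
    using eq[of j] cop by (metis coprime_commute coprime_dvd_mult_right_iff dvd_triv_left)
  then have "q dvd Gcd (range \<nu>)" by (intro Gcd_greatest) auto
  moreover have "p dvd \<nu>' j" for j
    using eq[of j] cop by (metis coprime_dvd_mult_right_iff dvd_triv_left)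
  then have "p dvd Gcd (range \<nu>')" by (intro Gcd_greatest) auto
  ultimately have "\<bar>q\<bar> = 1" "\<bar>p\<bar> = 1" using gcd gcd' by (simp_all add: zdvd1_eq)
  then show ?thesis using arg_cong[OF eq[of i], of abs] by (simp add: abs_mult)
qed

lemma proj_height_eqI:
  fixes x :: "rat ^ 'i::finite"
  assumes "c \<noteq> 0" "\<And>i. x $ i = c * rat_of_int (\<nu> i)" "Gcd (range \<nu>) = 1"
  shows "proj_height x = real_of_int (Max (range (\<lambda>i. \<bar>\<nu> i\<bar>)))"
  unfolding proj_height_def
proof (rule the_equality)
  fix H
  assume "\<exists>c \<nu>. c \<noteq> 0 \<and> (\<forall>i. x $ i = c * rat_of_int (\<nu> i)) \<and>
        Gcd (range \<nu>) = 1 \<and> H = real_of_int (Max (range (\<lambda>i. \<bar>\<nu> i\<bar>)))"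
  then obtain c' \<nu>' where *: "c' \<noteq> 0" "\<And>i. x $ i = c' * rat_of_int (\<nu>' i)"
    "Gcd (range \<nu>') = 1" "H = real_of_int (Max (range (\<lambda>i. \<bar>\<nu>' i\<bar>)))" by blast
  have "\<bar>\<nu>' i\<bar> = \<bar>\<nu> i\<bar>" for i
    using primitive_coords_unique[of c' c \<nu>' \<nu> i] * assms by metis
  then show "H = real_of_int (Max (range (\<lambda>i. \<bar>\<nu> i\<bar>)))" using * by simp
qed (use assms in blast)

text \<open>Division by the gcd of the entries never enlarges an entry. The last conclusion is why
  integer coordinates that are not coprime still bound the height from above.\<close>

lemma exists_primitive_coords_of_int:
  fixes x :: "rat ^ 'i::finite"
  assumes "x \<noteq> 0" and "\<And>i. x $ i = c * rat_of_int (\<mu> i)"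
  obtains c' \<nu> where "c' \<noteq> 0" "\<And>i. x $ i = c' * rat_of_int (\<nu> i)" "Gcd (range \<nu>) = 1"
    "\<And>i. \<bar>\<nu> i\<bar> \<le> \<bar>\<mu> i\<bar>"
proof -
  define g where "g = Gcd (range \<mu>)"
  obtain j where "x $ j \<noteq> 0" using assms(1) by (auto simp: vec_eq_iff)
  then have j: "\<mu> j \<noteq> 0" and c: "c \<noteq> 0" using assms(2)[of j] by auto
  have "g \<noteq> 0" using j unfolding g_def by (auto simp: Gcd_0_iff)
  moreover have "g \<ge> 0" unfolding g_def by simp
  ultimately have g: "g > 0" by simp
  define \<nu> where "\<nu> i = \<mu> i div g" for i
  have \<mu>: "\<mu> i = g * \<nu> i" for i
    unfolding \<nu>_def g_def by (simp add: Gcd_dvd)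
  have "Gcd (range \<mu>) = Gcd ((*) g ` range \<nu>)"
    by (rule arg_cong[of _ _ Gcd]) (auto simp: \<mu> image_image)
  also have "\<dots> = g * Gcd (range \<nu>)" using g by (simp add: Gcd_mult abs_mult)
  finally have "Gcd (range \<nu>) = 1" using g unfolding g_def[symmetric] by simp
  moreover have "x $ i = (c * of_int g) * of_int (\<nu> i)" for i
    using assms(2)[of i] by (simp add: \<mu>)
  moreover have "\<bar>\<nu> i\<bar> \<le> \<bar>\<mu> i\<bar>" for i
  proof -
    have "1 * \<bar>\<nu> i\<bar> \<le> g * \<bar>\<nu> i\<bar>" using g by (intro mult_right_mono) auto
    then show ?thesis using g by (simp add: \<mu> abs_mult)
  qed
  ultimately show ?thesis using that[of "c * of_int g" \<nu>] c g by auto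
qed

lemma exists_primitive_coords:
  fixes x :: "rat ^ 'i::finite"
  assumes "x \<noteq> 0"
  obtains c \<nu> where "c \<noteq> 0" "\<And>i. x $ i = c * rat_of_int (\<nu> i)" "Gcd (range \<nu>) = 1"
proof -
  define D where "D = (\<Prod>i\<in>UNIV. snd (quotient_of (x $ i)))"
  have D: "D \<noteq> 0"
    unfolding D_def using quotient_of_denom_pos' by (simp add: less_imp_neq[symmetric])
  have "\<exists>m. x $ i * rat_of_int D = rat_of_int m" for i
  proof -
    obtain p q where pq: "quotient_of (x $ i) = (p, q)" by force
    have "q > 0" "x $ i = of_int p / of_int q"
      using pq quotient_of_denom_pos quotient_of_div by blast+
    moreover have "q dvd D"
      unfolding D_def using dvd_prodI[of UNIV i "\<lambda>i. snd (quotient_of (x $ i))"] pq by simp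
    ultimately have "x $ i * rat_of_int D = rat_of_int (p * (D div q))"
      by (auto simp: dvd_def)
    then show ?thesis by blast
  qed
  then obtain \<mu> where "\<And>i. x $ i * rat_of_int D = rat_of_int (\<mu> i)" by metis
  then have "x $ i = (1 / of_int D) * of_int (\<mu> i)" for i
    using D by (simp add: field_simps)
  from exists_primitive_coords_of_int[OF assms this] that show thesis by metis
qed

lemma proj_height_le:
  fixes x :: "rat ^ 'i::finite"
  assumes "x \<noteq> 0" and "\<And>i. x $ i = c * rat_of_int (\<mu> i)" and "\<And>i. \<bar>\<mu> i\<bar> \<le> M"
  shows "proj_height x \<le> real_of_int M"
proof -
  obtain c' \<nu> where *: "c' \<noteq> 0" "\<And>i. x $ i = c' * rat_of_int (\<nu> i)" "Gcd (range \<nu>) = 1"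
    "\<And>i. \<bar>\<nu> i\<bar> \<le> \<bar>\<mu> i\<bar>"
    using exists_primitive_coords_of_int[OF assms(1,2)] by blast
  have "Max (range (\<lambda>i. \<bar>\<nu> i\<bar>)) \<le> M"
    using order_trans[OF *(4) assms(3)] by simp
  then show ?thesis using proj_height_eqI[OF *(1-3)] by simp
qed

lemma proj_height_coords:
  fixes x :: "rat ^ 'i::finite"
  assumes "x \<noteq> 0"
  obtains c \<nu> H where "c \<noteq> 0" "\<And>i. x $ i = c * rat_of_int (\<nu> i)" "\<And>i. \<bar>\<nu> i\<bar> \<le> H"
    "proj_height x = real_of_int H" "H \<ge> 1"
proof -
  obtain c \<nu> where *: "c \<noteq> 0" "\<And>i. x $ i = c * rat_of_int (\<nu> i)" "Gcd (range \<nu>) = 1"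
    using exists_primitive_coords[OF assms] by blast
  define H where "H = Max (range (\<lambda>i. \<bar>\<nu> i\<bar>))"
  have le: "\<bar>\<nu> i\<bar> \<le> H" for i unfolding H_def by (rule Max_ge) auto
  obtain j where "x $ j \<noteq> 0" using assms(1) by (auto simp: vec_eq_iff)
  then have "\<nu> j \<noteq> 0" using *(2)[of j] by auto
  then have "H \<ge> 1" using le[of j] by linarith
  then show ?thesis using that *(1,2) le proj_height_eqI[OF *] unfolding H_def by blast
qed

lemma affine_height_coords:
  fixes \<omega> :: "rat ^ 'n::finite"
  obtains w0 w H where "w0 \<noteq> 0" "\<And>i. \<omega> $ i = rat_of_int (w i) / rat_of_int w0" "\<bar>w0\<bar> \<le> H"
    "\<And>i. \<bar>w i\<bar> \<le> H" "affine_height \<omega> = real_of_int H" "H \<ge> 1"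
proof -
  define x :: "rat ^ 'n option" where
    "x = (\<chi> i. case i of None \<Rightarrow> 1 | Some j \<Rightarrow> \<omega> $ j)"
  have x: "x $ None = 1" "\<And>j. x $ Some j = \<omega> $ j" unfolding x_def by simp_all
  then have "x \<noteq> 0" by (metis zero_index zero_neq_one)
  then obtain c \<nu> H where *: "c \<noteq> 0" "\<And>i. x $ i = c * rat_of_int (\<nu> i)" "\<And>i. \<bar>\<nu> i\<bar> \<le> H"
    "proj_height x = real_of_int H" "H \<ge> 1"
    using proj_height_coords by blast
  have c: "1 = c * rat_of_int (\<nu> None)" using *(2)[of None] x by simp
  then have "\<nu> None \<noteq> 0" by auto
  moreover from this have "\<omega> $ j = rat_of_int (\<nu> (Some j)) / rat_of_int (\<nu> None)" for j
    using *(2)[of "Some j"] x(2)[of j] c by (simp add: field_simps)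
  ultimately show ?thesis
    using that[of "\<nu> None" "\<lambda>j. \<nu> (Some j)" H] *(3-5) x_def affine_height_def[of \<omega>] by simp
qed

lemma log_height_nonneg: "log_height \<omega> \<ge> 0"
  unfolding log_height_def
  by (rule affine_height_coords[of \<omega>]) simp

text \<open>Heights are integers, so exceeding 1 means being at least 2. This keeps
  \<open>log_height\<close> away from 0 where it is a divisor.\<close>

lemma log_height_ge_ln_2:
  assumes "affine_height \<omega> > 1"
  shows "log_height \<omega> \<ge> ln 2"
proof -
  obtain H where "affine_height \<omega> = real_of_int H" using affine_height_coords by metis
  then have "affine_height \<omega> \<ge> 2" using assms by simp
  then show ?thesis unfolding log_height_def by simp
qed

lemma ln_proj_height_ratio_le:
  assumes "v \<noteq> 0" "x = rat_of_int u / rat_of_int v" "\<bar>u\<bar> \<le> M" "\<bar>v\<bar> \<le> M"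
  shows "ln (proj_height (vector [x, 1] :: rat ^ 2)) \<le> ln (real_of_int M)"
proof -
  define \<mu> :: "2 \<Rightarrow> int" where "\<mu> i = (if i = 1 then u else v)" for i
  let ?x = "vector [x, 1] :: rat ^ 2"
  have nz: "?x \<noteq> 0" by (metis vector_2(2) zero_index zero_neq_one)
  have "?x $ i = (1 / of_int v) * of_int (\<mu> i)" for i
    using exhaust_2[of i] assms unfolding \<mu>_def by auto
  moreover have "\<bar>\<mu> i\<bar> \<le> M" for i using assms unfolding \<mu>_def by auto
  ultimately have "proj_height ?x \<le> real_of_int M" using proj_height_le[OF nz] by metis
  moreover have "proj_height ?x \<ge> 1" by (rule proj_height_coords[OF nz]) simp
  ultimately show ?thesis by simp
qed

lemma x_height_coords:
  obtains u v H where "v \<noteq> 0" "x = rat_of_int u / rat_of_int v" "\<bar>u\<bar> \<le> H" "\<bar>v\<bar> \<le> H"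
    "x_height (Affine x y) = ln (real_of_int H)" "H \<ge> 1"
proof -
  let ?x = "vector [x, 1] :: rat ^ 2"
  have "?x \<noteq> 0" by (metis vector_2(2) zero_index zero_neq_one)
  then obtain c \<nu> H where *: "c \<noteq> 0" "\<And>i. ?x $ i = c * rat_of_int (\<nu> i)" "\<And>i. \<bar>\<nu> i\<bar> \<le> H"
    "proj_height ?x = real_of_int H" "H \<ge> 1"
    using proj_height_coords by blast
  have c: "c * rat_of_int (\<nu> 2) = 1"
    using *(2)[of 2] unfolding vector_2 by (rule sym)
  have x: "x = c * rat_of_int (\<nu> 1)"
    using *(2)[of 1] unfolding vector_2 .
  have \<nu>: "\<nu> 2 \<noteq> 0" using c by fastforce
  have "x * rat_of_int (\<nu> 2) = rat_of_int (\<nu> 1) * (c * rat_of_int (\<nu> 2))"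
    unfolding x by simp
  then have "x * rat_of_int (\<nu> 2) = rat_of_int (\<nu> 1)" unfolding c by simp
  then have "x = rat_of_int (\<nu> 1) / rat_of_int (\<nu> 2)"
    using \<nu> by (simp add: field_simps)
  moreover have "x_height (Affine x y) = ln (real_of_int H)" using *(4) by simp
  ultimately show ?thesis
    using *(3)[of 1] *(3)[of 2] *(5) \<nu> by (intro that[of "\<nu> 2" "\<nu> 1" H])
qed

lemma x_height_nonneg: "x_height p \<ge> 0"
proof (cases p)
  case (Affine x y)
  show ?thesis unfolding Affine
    by (rule x_height_coords[of x y]) simp
qed simp

subsection \<open>Doubling and the canonical height\<close>

lemma point_add_self_curve:
  fixes E :: "rat weierstrass"
  assumes "p \<in> curve_points E"
  shows "point_add E p p \<in> curve_points E"
proof (cases p)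
  case Infinity
  then show ?thesis by (simp add: curve_points_def)
next
  case (Affine x y)
  show ?thesis
  proof (cases "y = 0")
    case True
    then show ?thesis using Affine by (simp add: curve_points_def)
  next
    case False
    define l where "l = (3 * x ^ 2 + coeff_a E) / (2 * y)"
    define z where "z = l ^ 2 - x - x"
    have "y ^ 2 = x ^ 3 + coeff_a E * x + coeff_b E"
      using assms Affine by (auto simp: curve_points_def)
    moreover have "2 * y * l = 3 * x ^ 2 + coeff_a E" using False by (simp add: l_def)
    ultimately have b: "coeff_b E = y ^ 2 - x ^ 3 - coeff_a E * x" and a: "coeff_a E = 2 * y * l - 3 * x ^ 2"
      by simp_all
    \<comment> \<open>Substituting the tangent line into the cubic leaves a polynomial with the
      double root \<open>x\<close> and the third root \<open>l ^ 2 - 2 * x\<close>. The identity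
      holds for every \<open>z\<close>; the next step takes \<open>z\<close> to be that
      root.\<close>
    have "z ^ 3 + coeff_a E * z + coeff_b E - (l * (x - z) - y) ^ 2 = (z - x) ^ 2 * (z + 2 * x - l ^ 2)"
      unfolding b a by (simp add: algebra_simps power2_eq_square power3_eq_cube)
    then have "(l * (x - z) - y) ^ 2 = z ^ 3 + coeff_a E * z + coeff_b E"
      by (simp add: z_def)
    moreover have "point_add E p p = Affine z (l * (x - z) - y)"
      using Affine False by (simp add: Let_def l_def z_def)
    ultimately show ?thesis by (simp add: curve_points_def)
  qed
qed

text \<open>After squaring the slope, \<open>y\<close> enters only through \<open>y ^ 2\<close>, so
  the abscissa of the double is a function of \<open>x\<close> alone. Its degree 4 is the origin of
  the factor 4 in the doubling estimate.\<close>

lemma duplication_formula: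
  fixes E :: "rat weierstrass"
  assumes "Affine x y \<in> curve_points E" "y \<noteq> 0"
  obtains y' where "point_add E (Affine x y) (Affine x y) =
    Affine ((x ^ 4 - 2 * coeff_a E * x ^ 2 - 8 * coeff_b E * x + coeff_a E ^ 2) /
            (4 * (x ^ 3 + coeff_a E * x + coeff_b E))) y'"
    "x ^ 3 + coeff_a E * x + coeff_b E \<noteq> 0"
proof -
  have y: "y ^ 2 = x ^ 3 + coeff_a E * x + coeff_b E"
    using assms by (auto simp: curve_points_def)
  define l where "l = (3 * x ^ 2 + coeff_a E) / (2 * y)"
  have l: "2 * y * l = 3 * x ^ 2 + coeff_a E" using assms by (simp add: l_def)
  have "(l ^ 2 - x - x) * (4 * y ^ 2) = x ^ 4 - 2 * coeff_a E * x ^ 2 - 8 * coeff_b E * x + coeff_a E ^ 2"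
  proof -
    have "(l ^ 2 - x - x) * (4 * y ^ 2) = (2 * y * l) ^ 2 - 8 * x * y ^ 2"
      by (simp add: algebra_simps power2_eq_square)
    also have "\<dots> = (3 * x ^ 2 + coeff_a E) ^ 2 - 8 * x * (x ^ 3 + coeff_a E * x + coeff_b E)"
      unfolding l y ..
    finally show ?thesis by (simp add: algebra_simps power2_eq_square power3_eq_cube power4_eq_xxxx)
  qed
  then have "l ^ 2 - x - x = (x ^ 4 - 2 * coeff_a E * x ^ 2 - 8 * coeff_b E * x + coeff_a E ^ 2) /
            (4 * (x ^ 3 + coeff_a E * x + coeff_b E))"
    using assms(2) unfolding y[symmetric] by (simp add: field_simps)
  moreover have "point_add E (Affine x y) (Affine x y) =
      Affine (l ^ 2 - x - x) (l * (x - (l ^ 2 - x - x)) - y)"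
    using assms(2) unfolding l_def by (simp add: Let_def)
  moreover have "x ^ 3 + coeff_a E * x + coeff_b E \<noteq> 0"
    using assms(2) y by (metis power_not_zero)
  ultimately show ?thesis using that by metis
qed

lemma abs_mult_le_mult:
  fixes a b c d :: int
  assumes "\<bar>a\<bar> \<le> c" "\<bar>b\<bar> \<le> d"
  shows "\<bar>a * b\<bar> \<le> c * d"
  unfolding abs_mult using assms by (intro mult_mono) auto

text \<open>Once homogenized, numerator and denominator of the duplication formula are forms of
  degree 4 in \<open>u\<close>, \<open>v\<close> and of degree 2 in \<open>D\<close>,
  \<open>\<alpha>\<close>, \<open>\<beta>\<close>; hence \<open>4 * x_height p\<close> and
  \<open>M ^ 2\<close>.\<close>

lemma x_height_double_le:
  fixes E :: "rat weierstrass"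
  assumes p: "p \<in> curve_points E"
    and D: "D \<noteq> 0" "coeff_a E = rat_of_int \<alpha> / rat_of_int D" "coeff_b E = rat_of_int \<beta> / rat_of_int D"
    and M: "\<bar>D\<bar> \<le> M" "\<bar>\<alpha>\<bar> \<le> M" "\<bar>\<beta>\<bar> \<le> M"
  shows "x_height (point_add E p p) \<le> 4 * x_height p + ln (12 * real_of_int M ^ 2)"
proof -
  have M1: "M \<ge> 1" using D(1) M(1) by linarith
  have M12: "ln (12 * real_of_int M ^ 2) \<ge> 0"
  proof -
    have "real_of_int M ^ 2 \<ge> 1" using M1 by simp
    then show ?thesis by simp
  qed
  show ?thesis
  proof (cases "\<exists>x y. p = Affine x y \<and> y \<noteq> 0")
    \<comment> \<open>Here \<open>p\<close> is \<open>Infinity\<close> or has \<open>y = 0\<close>,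
      and its double is \<open>Infinity\<close>, of height 0.\<close>
    case False
    then have "point_add E p p = Infinity" by (cases p) auto
    then show ?thesis using M12 x_height_nonneg[of p] by simp
  next
    case True
    then obtain x y where xy: "p = Affine x y" "y \<noteq> 0" by blast
    let ?a = "coeff_a E" and ?b = "coeff_b E"
    obtain y' where y': "point_add E p p =
      Affine ((x ^ 4 - 2 * ?a * x ^ 2 - 8 * ?b * x + ?a ^ 2) / (4 * (x ^ 3 + ?a * x + ?b))) y'"
      "x ^ 3 + ?a * x + ?b \<noteq> 0"
      using duplication_formula p xy by metis
    obtain u v H where *: "v \<noteq> 0" "x = rat_of_int u / rat_of_int v" "\<bar>u\<bar> \<le> H" "\<bar>v\<bar> \<le> H"
      "x_height p = ln (real_of_int H)" "H \<ge> 1"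
      using x_height_coords[of x y] unfolding xy(1) by metis
    \<comment> \<open>\<open>s\<close> and \<open>r\<close> are the two parts of the quotient
      multiplied by \<open>D ^ 2 * v ^ 4\<close>. Each product is bracketed as two factors from
      \<open>D\<close>, \<open>\<alpha>\<close>, \<open>\<beta>\<close> times four from
      \<open>u\<close>, \<open>v\<close>, so that bounding factor by factor yields \<open>?K\<close>
      literally.\<close>
    define s where "s = D * D * (u * u * (u * u)) - 2 * (\<alpha> * D * (u * u * (v * v))) - 8 * (\<beta> * D * (u * v * (v * v)))
      + \<alpha> * \<alpha> * (v * v * (v * v))"
    define r where "r = 4 * (D * D * (u * u * (u * v))) + 4 * (\<alpha> * D * (u * v * (v * v))) + 4 * (\<beta> * D * (v * v * (v * v)))"
    have s: "rat_of_int s = (of_int D ^ 2 * of_int v ^ 4) * (x ^ 4 - 2 * ?a * x ^ 2 - 8 * ?b * x + ?a ^ 2)"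
      unfolding s_def D *(2) using D(1) *(1) by (simp add: field_simps power2_eq_square power4_eq_xxxx)
    have r: "rat_of_int r = (of_int D ^ 2 * of_int v ^ 4) * (4 * (x ^ 3 + ?a * x + ?b))"
      unfolding r_def D *(2) using D(1) *(1)
      by (simp add: field_simps power2_eq_square power3_eq_cube power4_eq_xxxx)
    have r0: "r \<noteq> 0" using r y'(2) D(1) *(1)
      by (metis mult_eq_0_iff of_int_0 of_int_eq_0_iff power_not_zero zero_neq_numeral)
    have ratio: "(x ^ 4 - 2 * ?a * x ^ 2 - 8 * ?b * x + ?a ^ 2) / (4 * (x ^ 3 + ?a * x + ?b))
      = rat_of_int s / rat_of_int r"
      unfolding s r using D(1) *(1) by simp
    note ab = abs_mult_le_mult
    let ?K = "M * M * (H * H * (H * H))"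
    have b: "\<bar>D * D * (u * u * (u * u))\<bar> \<le> ?K" "\<bar>\<alpha> * D * (u * u * (v * v))\<bar> \<le> ?K" "\<bar>\<beta> * D * (u * v * (v * v))\<bar> \<le> ?K"
      "\<bar>\<alpha> * \<alpha> * (v * v * (v * v))\<bar> \<le> ?K" "\<bar>D * D * (u * u * (u * v))\<bar> \<le> ?K" "\<bar>\<alpha> * D * (u * v * (v * v))\<bar> \<le> ?K"
      "\<bar>\<beta> * D * (v * v * (v * v))\<bar> \<le> ?K"
      by (intro ab M *(3,4))+
    \<comment> \<open>12 is the sum of the absolute values of the coefficients: 1 + 2 + 8 + 1 in
      \<open>s\<close> and 4 + 4 + 4 in \<open>r\<close>.\<close>
    have "\<bar>s\<bar> \<le> 12 * ?K" "\<bar>r\<bar> \<le> 12 * ?K" unfolding s_def r_def using b by linarith+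
    then have "x_height (point_add E p p) \<le> ln (real_of_int (12 * ?K))"
      unfolding y'(1) x_height.simps
      by (intro ln_proj_height_ratio_le[OF r0 ratio])
    also have "\<dots> = ln (12 * real_of_int M ^ 2 * real_of_int H ^ 4)"
      by (simp add: power2_eq_square power4_eq_xxxx mult_ac)
    also have "\<dots> = ln (12 * real_of_int M ^ 2) + 4 * ln (real_of_int H)"
      using M1 *(6) by (subst ln_mult) (auto simp: ln_realpow)
    finally show ?thesis using *(5) by simp
  qed
qed

lemma point_mult_0: "point_mult E 0 p = Infinity"
  by (subst point_mult.simps) simp

lemma point_mult_1: "point_mult E (Suc 0) p = p"
  by (subst point_mult.simps) (cases p; simp add: point_mult_0)

text \<open>For an even multiplier the recursion of \<open>point_mult\<close> is itself a doubling,
  so the multiples in \<open>canonical_height\<close> are iterated doubles by definition.\<close>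

lemma point_mult_power_Suc:
  "point_mult E (2 ^ Suc m) p = point_add E (point_mult E (2 ^ m) p) (point_mult E (2 ^ m) p)"
  by (subst point_mult.simps) simp

lemma point_mult_power_curve:
  fixes E :: "rat weierstrass"
  assumes "p \<in> curve_points E"
  shows "point_mult E (2 ^ m) p \<in> curve_points E"
proof (induction m)
  case 0
  then show ?case using assms by (simp add: point_mult_1)
next
  case (Suc m)
  then show ?case unfolding point_mult_power_Suc by (rule point_add_self_curve)
qed

text \<open>
  The upper bound for the height of a double alone makes \<open>4\<^sup>-\<^sup>m h(2\<^sup>m p) + 4\<^sup>-\<^sup>m C / 3\<close> decreasing;
  as it is nonnegative, the limit exists without any lower bound for the height of a double.
\<close>

lemma canonical_height_le:
  fixes E :: "rat weierstrass"
  assumes p: "p \<in> curve_points E"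
    and double: "\<And>q. q \<in> curve_points E \<Longrightarrow> x_height (point_add E q q) \<le> 4 * x_height q + C"
    and C: "C \<ge> 0"
  shows "canonical_height E p \<le> x_height p + C / 3"
proof -
  define a where "a m = x_height (point_mult E (2 ^ m) p) / 4 ^ m" for m
  \<comment> \<open>The shift \<open>C / 3\<close> is chosen because
    \<open>4 * (C / 3) = C + C / 3\<close>: the height plus \<open>C / 3\<close> at most quadruples
    under doubling.\<close>
  define s where "s m = a m + (C / 3) / 4 ^ m" for m
  have "s (Suc m) \<le> s m" for m
  proof -
    have "x_height (point_mult E (2 ^ Suc m) p) \<le> 4 * x_height (point_mult E (2 ^ m) p) + C"
      unfolding point_mult_power_Suc by (intro double point_mult_power_curve p)
    then have "a (Suc m) \<le> (4 * x_height (point_mult E (2 ^ m) p) + C) / 4 ^ Suc m"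
      unfolding a_def by (rule divide_right_mono) simp
    then show ?thesis unfolding s_def a_def by (simp add: add_divide_distrib)
  qed
  then have dec: "decseq s" by (rule decseq_SucI)
  have a0: "a m \<ge> 0" for m unfolding a_def by (simp add: x_height_nonneg)
  then have "\<forall>m. 0 \<le> s m" unfolding s_def using C by (intro allI add_nonneg_nonneg) auto
  with dec obtain L where L: "s \<longlonglongrightarrow> L" by (rule decseq_convergent)
  have "(\<lambda>m. (C / 3) / 4 ^ m) \<longlonglongrightarrow> 0" by (rule LIMSEQ_divide_realpow_zero) simp
  from tendsto_diff[OF L this] have "a \<longlonglongrightarrow> L" unfolding s_def by simp
  then have "canonical_height E p = L"
    unfolding canonical_height_def a_def[symmetric] by (rule limI)
  moreover have "L \<le> s 0" by (rule decseq_ge[OF dec L])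
  ultimately show ?thesis unfolding s_def a_def by (simp add: point_mult_1)
qed

subsection \<open>Evaluation of polynomials\<close>

definition eval_monom :: "('n::finite \<Rightarrow>\<^sub>0 nat) \<Rightarrow> rat ^ 'n \<Rightarrow> rat" where
  "eval_monom m \<omega> = (\<Prod>i\<in>UNIV. (\<omega> $ i) ^ Poly_Mapping.lookup m i)"

lemma eval_monom_add: "eval_monom (m + m') \<omega> = eval_monom m \<omega> * eval_monom m' \<omega>"
  unfolding eval_monom_def by (simp add: lookup_add power_add prod.distrib)

lemma eval_mpoly_superset:
  assumes "finite K" "Poly_Mapping.keys p \<subseteq> K"
  shows "eval_mpoly p \<omega> = (\<Sum>m\<in>K. Poly_Mapping.lookup p m * eval_monom m \<omega>)"
  unfolding eval_mpoly_def eval_monom_def[symmetric]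
  by (intro sum.mono_neutral_left assms) (simp add: in_keys_iff)

lemma eval_mpoly_0 [simp]: "eval_mpoly 0 \<omega> = 0"
  by (simp add: eval_mpoly_def)

lemma eval_mpoly_add [simp]: "eval_mpoly (p + q) \<omega> = eval_mpoly p \<omega> + eval_mpoly q \<omega>"
proof -
  let ?K = "Poly_Mapping.keys p \<union> Poly_Mapping.keys q"
  note sup = eval_mpoly_superset[where K = ?K and \<omega> = \<omega>]
  show ?thesis
    using keys_add[of p q] by (simp add: sup lookup_add distrib_right sum.distrib)
qed

lemma eval_mpoly_single: "eval_mpoly (Poly_Mapping.single m c) \<omega> = c * eval_monom m \<omega>"
  by (subst eval_mpoly_superset[of "{m}"]) auto

text \<open>Turns the step of \<open>update_induct\<close> into an addition, so that additivity of
  evaluation applies.\<close>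

lemma update_conv_add_single:
  assumes "a \<notin> Poly_Mapping.keys f"
  shows "Poly_Mapping.update a b f = f + Poly_Mapping.single a b"
  using assms
  by (intro poly_mapping_eqI)
    (auto simp: lookup_update lookup_add lookup_single in_keys_iff when_def)

text \<open>Both sides are additive in each factor, so building \<open>q\<close> and
  \<open>p\<close> up one monomial at a time reduces the claim to
  \<open>eval_monom_add\<close>.\<close>

lemma eval_mpoly_mult [simp]: "eval_mpoly (p * q) \<omega> = eval_mpoly p \<omega> * eval_mpoly q \<omega>"
proof -
  have single: "eval_mpoly (Poly_Mapping.single a b * q) \<omega> = b * eval_monom a \<omega> * eval_mpoly q \<omega>" for a b
    by (induction q rule: update_induct)
      (simp_all add: update_conv_add_single distrib_left mult_single eval_mpoly_single eval_monom_add)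
  show ?thesis
    by (induction p rule: update_induct)
      (simp_all add: update_conv_add_single distrib_right single eval_mpoly_single)
qed

text \<open>Induction on the number of variables: with all variables but \<open>j\<close> fixed, the
  sum is a univariate polynomial vanishing at every rational, so each of its coefficients vanishes,
  and these are sums of the same kind in fewer variables. Abstract indices and exponents let the
  index set shrink while exponents need only be told apart on the remaining variables.\<close>

lemma exponential_sum_eq_0_imp:
  fixes c :: "'m \<Rightarrow> rat" and e :: "'m \<Rightarrow> 'n \<Rightarrow> nat"
  assumes "finite S" "finite K"
    and "\<And>m m'. m \<in> K \<Longrightarrow> m' \<in> K \<Longrightarrow> (\<forall>i\<in>S. e m i = e m' i) \<Longrightarrow> m = m'"
    and "\<And>x :: 'n \<Rightarrow> rat. (\<Sum>m\<in>K. c m * (\<Prod>i\<in>S. x i ^ e m i)) = 0"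
    and "m \<in> K"
  shows "c m = 0"
  using assms
proof (induction S arbitrary: K m rule: finite_induct)
  case empty
  \<comment> \<open>Without variables all exponents agree vacuously, so separation leaves a single
    index and the sum is \<open>c m\<close>.\<close>
  then have "K = {m}" by blast
  then show ?case using empty.prems(3) by simp
next
  case (insert j S)
  define L where "L = {m' \<in> K. e m' j = e m j}"
  have "(\<Sum>m'\<in>L. c m' * (\<Prod>i\<in>S. x i ^ e m' i)) = 0" for x
  proof -
    \<comment> \<open>\<open>q\<close> is the sum as a polynomial in the variable \<open>j\<close>;
      its coefficient at \<open>e m j\<close> collects exactly the terms indexed by
      \<open>L\<close>.\<close>
    define q where "q = (\<Sum>m'\<in>K. monom (c m' * (\<Prod>i\<in>S. x i ^ e m' i)) (e m' j))"
    have "poly q t = 0" for t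
    proof -
      have "(\<Prod>i\<in>S. (x(j := t)) i ^ e m' i) = (\<Prod>i\<in>S. x i ^ e m' i)" for m'
        using insert.hyps by (intro prod.cong) auto
      then show ?thesis
        using insert.prems(3)[of "x(j := t)"] insert.hyps
        by (simp add: q_def poly_sum poly_monom mult_ac)
    qed
    then have "q = 0" using poly_all_0_iff_0 by blast
    then have "coeff q (e m j) = 0" by simp
    moreover have "coeff q (e m j) = (\<Sum>m'\<in>K. if e m' j = e m j then c m' * (\<Prod>i\<in>S. x i ^ e m' i) else 0)"
      unfolding q_def coeff_sum by (intro sum.cong) auto
    ultimately show ?thesis
      using insert.prems(1) by (simp add: L_def sum.inter_filter)
  qed
  moreover have "finite L" "m \<in> L" using insert.prems(1,4) by (auto simp: L_def)
  moreover have "m1 = m2" if "m1 \<in> L" "m2 \<in> L" "\<forall>i\<in>S. e m1 i = e m2 i" for m1 m2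
    using insert.prems(2)[of m1 m2] that by (auto simp: L_def)
  ultimately show ?case using insert.IH[of L m] by blast
qed

lemma exists_eval_mpoly_nonzero:
  fixes p :: "('n::finite, rat) mpoly"
  assumes "p \<noteq> 0"
  shows "\<exists>\<omega>. eval_mpoly p \<omega> \<noteq> 0"
proof (rule ccontr)
  assume "\<not> ?thesis"
  then have zero: "eval_mpoly p (\<chi> i. x i) = 0" for x by blast
  have "Poly_Mapping.lookup p m = 0" if "m \<in> Poly_Mapping.keys p" for m
  proof (rule exponential_sum_eq_0_imp[of UNIV "Poly_Mapping.keys p" Poly_Mapping.lookup])
    fix x :: "'n \<Rightarrow> rat"
    show "(\<Sum>m\<in>Poly_Mapping.keys p. Poly_Mapping.lookup p m * (\<Prod>i\<in>UNIV. x i ^ Poly_Mapping.lookup m i)) = 0"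
      using zero[of x] by (simp add: eval_mpoly_def)
  qed (use that in \<open>auto intro: poly_mapping_eqI\<close>)
  then have "p = 0" by (intro poly_mapping_eqI) (auto simp: in_keys_iff)
  then show False using assms by simp
qed

section \<open>Restriction of polynomials to a line\<close>

text \<open>The parameter 0 corresponds to \<open>\<omega>\<close> and 1 to
  \<open>\<omega>\<^sub>0\<close>. Spelling out the substitution shows that the coefficients are
  polynomial in \<open>\<omega>\<close>, which the height bounds rely on.\<close>

definition restrict_line :: "('n::finite, rat) mpoly \<Rightarrow> rat ^ 'n \<Rightarrow> rat ^ 'n \<Rightarrow> rat poly" where
  "restrict_line p \<omega>\<^sub>0 \<omega> = (\<Sum>m\<in>Poly_Mapping.keys p. smult (Poly_Mapping.lookup p m)
     (\<Prod>i\<in>UNIV. [:\<omega> $ i, \<omega>\<^sub>0 $ i - \<omega> $ i:] ^ Poly_Mapping.lookup m i))"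

lemma poly_restrict_line:
  "poly (restrict_line p \<omega>\<^sub>0 \<omega>) t = eval_mpoly p (\<chi> i. \<omega> $ i + t * (\<omega>\<^sub>0 $ i - \<omega> $ i))"
  by (simp add: restrict_line_def eval_mpoly_def poly_sum poly_prod)

lemma coeff_0_restrict_line: "coeff (restrict_line p \<omega>\<^sub>0 \<omega>) 0 = eval_mpoly p \<omega>"
  unfolding poly_0_coeff_0[symmetric] poly_restrict_line by simp

lemma restrict_line_nonzero:
  assumes "eval_mpoly p \<omega>\<^sub>0 \<noteq> 0"
  shows "restrict_line p \<omega>\<^sub>0 \<omega> \<noteq> 0"
proof -
  have "poly (restrict_line p \<omega>\<^sub>0 \<omega>) 1 = eval_mpoly p \<omega>\<^sub>0"
    unfolding poly_restrict_line by simp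
  then show ?thesis using assms by auto
qed

text \<open>Over the infinite field of rationals a univariate polynomial is determined by its
  values, and on values this is \<open>eval_mpoly_mult\<close>.\<close>

lemma restrict_line_mult:
  "restrict_line (p * q) \<omega>\<^sub>0 \<omega> = restrict_line p \<omega>\<^sub>0 \<omega> * restrict_line q \<omega>\<^sub>0 \<omega>"
proof -
  have "poly (restrict_line (p * q) \<omega>\<^sub>0 \<omega>) = poly (restrict_line p \<omega>\<^sub>0 \<omega> * restrict_line q \<omega>\<^sub>0 \<omega>)"
    by (rule ext) (simp add: poly_restrict_line)
  then show ?thesis by (simp only: poly_eq_poly_eq_iff)
qed

text \<open>What matters is uniformity in \<open>\<omega>\<close>: it leaves only finitely many
  possible orders of vanishing. The sum of the total degrees of all monomials is a crude substitute
  for their maximum.\<close>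

lemma degree_restrict_line_le: "\<exists>d. \<forall>\<omega>. degree (restrict_line p \<omega>\<^sub>0 \<omega>) \<le> d"
proof -
  define f where "f m = (\<Sum>i\<in>UNIV. Poly_Mapping.lookup m i)" for m :: "'a \<Rightarrow>\<^sub>0 nat"
  have "degree (restrict_line p \<omega>\<^sub>0 \<omega>) \<le> (\<Sum>m\<in>Poly_Mapping.keys p. f m)" for \<omega>
    unfolding restrict_line_def
  proof (rule degree_sum_le)
    fix m assume m: "m \<in> Poly_Mapping.keys p"
    let ?q = "\<Prod>i\<in>UNIV. [:\<omega> $ i, \<omega>\<^sub>0 $ i - \<omega> $ i:] ^ Poly_Mapping.lookup m i"
    have "degree ?q \<le> (\<Sum>i\<in>UNIV. degree ([:\<omega> $ i, \<omega>\<^sub>0 $ i - \<omega> $ i:] ^ Poly_Mapping.lookup m i))"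
      using degree_prod_sum_le[OF finite] by (simp add: o_def)
    also have "\<dots> \<le> f m" unfolding f_def
    proof (rule sum_mono)
      fix i
      have "degree ([:\<omega> $ i, \<omega>\<^sub>0 $ i - \<omega> $ i:] ^ Poly_Mapping.lookup m i)
        \<le> degree [:\<omega> $ i, \<omega>\<^sub>0 $ i - \<omega> $ i:] * Poly_Mapping.lookup m i"
        by (rule degree_power_le)
      also have "\<dots> \<le> 1 * Poly_Mapping.lookup m i" by (intro mult_right_mono) auto
      finally show "degree ([:\<omega> $ i, \<omega>\<^sub>0 $ i - \<omega> $ i:] ^ Poly_Mapping.lookup m i) \<le> Poly_Mapping.lookup m i"
        by simp
    qed
    also have "\<dots> \<le> (\<Sum>m\<in>Poly_Mapping.keys p. f m)" using m by (intro member_le_sum) auto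
    finally show "degree (smult (Poly_Mapping.lookup p m) ?q) \<le> (\<Sum>m\<in>Poly_Mapping.keys p. f m)"
      using degree_smult_le order_trans by blast
  qed simp
  then show ?thesis by blast
qed

subsection \<open>Functions whose values have controlled height\<close>

text \<open>Models a polynomial function of degree at most \<open>d\<close>: \<open>N\<close> clears
  its coefficients and \<open>w\<^sub>0 ^ d\<close> the denominators of \<open>\<omega>\<close>. The
  coordinates of \<open>\<omega>\<close> need not be primitive. Requiring \<open>C \<ge> 1\<close>
  keeps \<open>ln C\<close> nonnegative later.\<close>

definition cleared :: "int \<Rightarrow> int \<Rightarrow> nat \<Rightarrow> (rat ^ 'n::finite \<Rightarrow> rat) \<Rightarrow> bool" where
  "cleared N C d f \<longleftrightarrow> N \<ge> 1 \<and> C \<ge> 1 \<and>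
     (\<forall>\<omega> w\<^sub>0 w H. w\<^sub>0 \<noteq> 0 \<longrightarrow> (\<forall>i. \<omega> $ i = rat_of_int (w i) / rat_of_int w\<^sub>0) \<longrightarrow>
        \<bar>w\<^sub>0\<bar> \<le> H \<longrightarrow> (\<forall>i. \<bar>w i\<bar> \<le> H) \<longrightarrow>
        (\<exists>u. rat_of_int (N * w\<^sub>0 ^ d) * f \<omega> = rat_of_int u \<and> \<bar>u\<bar> \<le> C * H ^ d))"

lemma clearedD:
  assumes "cleared N C d f" "w\<^sub>0 \<noteq> 0" "\<And>i. \<omega> $ i = rat_of_int (w i) / rat_of_int w\<^sub>0"
    "\<bar>w\<^sub>0\<bar> \<le> H" "\<And>i. \<bar>w i\<bar> \<le> H"
  obtains u where "rat_of_int (N * w\<^sub>0 ^ d) * f \<omega> = rat_of_int u" "\<bar>u\<bar> \<le> C * H ^ d"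
  using assms unfolding cleared_def by blast

lemma cleared_weaken:
  assumes f: "cleared N C d f" and k: "k \<ge> 1"
  shows "cleared (N * k) (C * k) (d + e) f"
  unfolding cleared_def
proof (intro conjI allI impI)
  have N: "N \<ge> 1" "C \<ge> 1" using f by (auto simp: cleared_def)
  then show "N * k \<ge> 1" "C * k \<ge> 1" using k mult_mono[of 1 N 1 k] mult_mono[of 1 C 1 k] by auto
  fix \<omega> :: "rat ^ 'a" and w\<^sub>0 w H
  assume w: "w\<^sub>0 \<noteq> 0" "\<forall>i. \<omega> $ i = rat_of_int (w i) / rat_of_int w\<^sub>0" "\<bar>w\<^sub>0\<bar> \<le> H" "\<forall>i. \<bar>w i\<bar> \<le> H"
  obtain u where u: "rat_of_int (N * w\<^sub>0 ^ d) * f \<omega> = rat_of_int u" "\<bar>u\<bar> \<le> C * H ^ d"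
    using clearedD[OF f] w by metis
  have "rat_of_int (N * k * w\<^sub>0 ^ (d + e)) * f \<omega> = rat_of_int (k * w\<^sub>0 ^ e) * (rat_of_int (N * w\<^sub>0 ^ d) * f \<omega>)"
    by (simp add: power_add)
  also have "\<dots> = rat_of_int (u * (k * w\<^sub>0 ^ e))" unfolding u(1) by simp
  finally have 1: "rat_of_int (N * k * w\<^sub>0 ^ (d + e)) * f \<omega> = rat_of_int (u * (k * w\<^sub>0 ^ e))" .
  have "\<bar>w\<^sub>0 ^ e\<bar> \<le> H ^ e" unfolding power_abs by (rule power_mono) (use w in auto)
  then have "\<bar>u * (k * w\<^sub>0 ^ e)\<bar> \<le> C * H ^ d * (k * H ^ e)"
    using k by (intro abs_mult_le_mult u(2)) auto
  then show "\<exists>u. rat_of_int (N * k * w\<^sub>0 ^ (d + e)) * f \<omega> = rat_of_int u \<and> \<bar>u\<bar> \<le> C * k * H ^ (d + e)"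
    using 1 by (intro exI[of _ "u * (k * w\<^sub>0 ^ e)"]) (simp add: power_add mult_ac)
qed

definition controlled :: "(rat ^ 'n::finite \<Rightarrow> rat) \<Rightarrow> bool" where
  "controlled f \<longleftrightarrow> (\<exists>N C d. cleared N C d f)"

text \<open>Numerators can be added or compared only over the same multiplier
  \<open>N * w\<^sub>0 ^ d\<close>; each function takes over the multiplier of the other through
  \<open>cleared_weaken\<close>.\<close>

lemma controlled_common:
  assumes "controlled f" "controlled g"
  obtains N C C' d where "cleared N C d f" "cleared N C' d g"
proof -
  obtain N C d N' C' d' where *: "cleared N C d f" "cleared N' C' d' g"
    using assms unfolding controlled_def by blast
  have "N \<ge> 1" "N' \<ge> 1" using * by (auto simp: cleared_def)
  then have "cleared (N * N') (C * N') (d + d') f" "cleared (N' * N) (C' * N) (d' + d) g"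
    by (auto intro!: cleared_weaken *)
  then show ?thesis using that by (metis mult.commute add.commute)
qed

lemma controlled_const [intro]: "controlled (\<lambda>_. c)"
proof -
  obtain p q where "quotient_of c = (p, q)" by force
  then have "q > 0" "c = of_int p / of_int q"
    using quotient_of_denom_pos quotient_of_div by blast+
  \<comment> \<open>The summand 1 secures \<open>C \<ge> 1\<close> when the constant is 0.\<close>
  then have "cleared q (\<bar>p\<bar> + 1) 0 (\<lambda>_. c)" unfolding cleared_def by auto
  then show ?thesis unfolding controlled_def by blast
qed

lemma controlled_component [intro]: "controlled (\<lambda>\<omega>. \<omega> $ i)"
proof -
  have "cleared 1 1 1 (\<lambda>\<omega>. \<omega> $ i)" unfolding cleared_def by auto
  then show ?thesis unfolding controlled_def by blast
qed

lemma controlled_add [intro]: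
  assumes "controlled f" "controlled g"
  shows "controlled (\<lambda>\<omega>. f \<omega> + g \<omega>)"
proof -
  obtain N C C' d where *: "cleared N C d f" "cleared N C' d g"
    using controlled_common[OF assms] by blast
  have "cleared N (C + C') d (\<lambda>\<omega>. f \<omega> + g \<omega>)"
    unfolding cleared_def
  proof (intro conjI allI impI)
    show "N \<ge> 1" "C + C' \<ge> 1" using * by (auto simp: cleared_def)
    fix \<omega> :: "rat ^ 'a" and w\<^sub>0 w H
    assume w: "w\<^sub>0 \<noteq> 0" "\<forall>i. \<omega> $ i = rat_of_int (w i) / rat_of_int w\<^sub>0" "\<bar>w\<^sub>0\<bar> \<le> H" "\<forall>i. \<bar>w i\<bar> \<le> H"
    obtain u where u: "rat_of_int (N * w\<^sub>0 ^ d) * f \<omega> = rat_of_int u" "\<bar>u\<bar> \<le> C * H ^ d"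
      using clearedD[OF *(1)] w by metis
    obtain v where v: "rat_of_int (N * w\<^sub>0 ^ d) * g \<omega> = rat_of_int v" "\<bar>v\<bar> \<le> C' * H ^ d"
      using clearedD[OF *(2)] w by metis
    have "rat_of_int (N * w\<^sub>0 ^ d) * (f \<omega> + g \<omega>) = rat_of_int (u + v)"
      unfolding distrib_left u v by simp
    moreover have "\<bar>u + v\<bar> \<le> (C + C') * H ^ d"
      unfolding distrib_right using u(2) v(2) by linarith
    ultimately show "\<exists>u. rat_of_int (N * w\<^sub>0 ^ d) * (f \<omega> + g \<omega>) = rat_of_int u \<and> \<bar>u\<bar> \<le> (C + C') * H ^ d"
      by blast
  qed
  then show ?thesis unfolding controlled_def by blast
qed

lemma controlled_mult [intro]:
  assumes "controlled f" "controlled g"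
  shows "controlled (\<lambda>\<omega>. f \<omega> * g \<omega>)"
proof -
  obtain N C C' d where *: "cleared N C d f" "cleared N C' d g"
    using controlled_common[OF assms] by blast
  have "cleared (N * N) (C * C') (d + d) (\<lambda>\<omega>. f \<omega> * g \<omega>)"
    unfolding cleared_def
  proof (intro conjI allI impI)
    have "N \<ge> 1" "C \<ge> 1" "C' \<ge> 1" using * by (auto simp: cleared_def)
    then show "N * N \<ge> 1" "C * C' \<ge> 1" using mult_mono[of 1 N 1 N] mult_mono[of 1 C 1 C'] by auto
    fix \<omega> :: "rat ^ 'a" and w\<^sub>0 w H
    assume w: "w\<^sub>0 \<noteq> 0" "\<forall>i. \<omega> $ i = rat_of_int (w i) / rat_of_int w\<^sub>0" "\<bar>w\<^sub>0\<bar> \<le> H" "\<forall>i. \<bar>w i\<bar> \<le> H"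
    obtain u where u: "rat_of_int (N * w\<^sub>0 ^ d) * f \<omega> = rat_of_int u" "\<bar>u\<bar> \<le> C * H ^ d"
      using clearedD[OF *(1)] w by metis
    obtain v where v: "rat_of_int (N * w\<^sub>0 ^ d) * g \<omega> = rat_of_int v" "\<bar>v\<bar> \<le> C' * H ^ d"
      using clearedD[OF *(2)] w by metis
    have "rat_of_int (N * N * w\<^sub>0 ^ (d + d)) * (f \<omega> * g \<omega>) =
      (rat_of_int (N * w\<^sub>0 ^ d) * f \<omega>) * (rat_of_int (N * w\<^sub>0 ^ d) * g \<omega>)"
      by (simp add: power_add mult_ac)
    then have "rat_of_int (N * N * w\<^sub>0 ^ (d + d)) * (f \<omega> * g \<omega>) = rat_of_int (u * v)"
      unfolding u v by simp
    moreover have "\<bar>u * v\<bar> \<le> (C * H ^ d) * (C' * H ^ d)"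
      by (intro abs_mult_le_mult u v)
    then have "\<bar>u * v\<bar> \<le> C * C' * H ^ (d + d)" by (simp add: power_add mult_ac)
    ultimately show "\<exists>u. rat_of_int (N * N * w\<^sub>0 ^ (d + d)) * (f \<omega> * g \<omega>) = rat_of_int u \<and>
        \<bar>u\<bar> \<le> C * C' * H ^ (d + d)"
      by blast
  qed
  then show ?thesis unfolding controlled_def by blast
qed

lemma controlled_sum [intro]:
  assumes "\<And>k. k \<in> K \<Longrightarrow> controlled (f k)"
  shows "controlled (\<lambda>\<omega>. \<Sum>k\<in>K. f k \<omega>)"
  using assms by (induction K rule: infinite_finite_induct) (auto intro!: controlled_add)

lemma controlled_prod:
  assumes "\<And>k. k \<in> K \<Longrightarrow> controlled (f k)"
  shows "controlled (\<lambda>\<omega>. \<Prod>k\<in>K. f k \<omega>)"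
  using assms by (induction K rule: infinite_finite_induct) (auto intro!: controlled_mult)

lemma controlled_power:
  assumes "controlled f"
  shows "controlled (\<lambda>\<omega>. f \<omega> ^ k)"
  using assms by (induction k) (auto intro!: controlled_mult)

lemma controlled_eval_mpoly: "controlled (eval_mpoly p)"
  unfolding eval_mpoly_def
  by (intro controlled_sum controlled_mult controlled_const controlled_prod controlled_power controlled_component)

lemma controlled_coeff_mult:
  assumes "\<And>k. controlled (\<lambda>\<omega>. coeff (F \<omega>) k)" "\<And>k. controlled (\<lambda>\<omega>. coeff (G \<omega>) k)"
  shows "controlled (\<lambda>\<omega>. coeff (F \<omega> * G \<omega>) k)"
  unfolding coeff_mult by (intro controlled_sum controlled_mult assms)

lemma controlled_coeff_power:
  assumes "\<And>k. controlled (\<lambda>\<omega>. coeff (F \<omega>) k)"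
  shows "controlled (\<lambda>\<omega>. coeff (F \<omega> ^ j) k)"
  by (induction j arbitrary: k) (auto intro!: controlled_coeff_mult assms)

lemma controlled_coeff_prod:
  assumes "\<And>j k. controlled (\<lambda>\<omega>. coeff (F j \<omega>) k)"
  shows "controlled (\<lambda>\<omega>. coeff (\<Prod>j\<in>J. F j \<omega>) k)"
  by (induction J arbitrary: k rule: infinite_finite_induct) (auto intro!: controlled_coeff_mult assms)

lemma controlled_coeff_restrict_line: "controlled (\<lambda>\<omega>. coeff (restrict_line p \<omega>\<^sub>0 \<omega>) k)"
proof -
  have "controlled (\<lambda>\<omega>. coeff [:\<omega> $ i, \<omega>\<^sub>0 $ i - \<omega> $ i:] k)" for i k
  proof -
    \<comment> \<open>The difference is written with a factor -1 because closure is available for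
      sums and products only.\<close>
    have "controlled (\<lambda>\<omega>. \<omega>\<^sub>0 $ i + (- 1) * \<omega> $ i)"
      by (intro controlled_add controlled_mult controlled_const controlled_component)
    then show ?thesis
      by (cases k; cases "k - 1") (auto simp: coeff_pCons)
  qed
  then show ?thesis
    unfolding restrict_line_def coeff_sum coeff_smult
    by (intro controlled_sum controlled_mult controlled_const controlled_coeff_prod controlled_coeff_power)
qed

text \<open>The right-hand side exceeds the left by \<open>ln C * ln H\<close> and \<open>d\<close>,
  both nonnegative; adding them makes the bound a multiple of \<open>1 + ln H\<close>.\<close>

lemma ln_growth_le:
  assumes "C \<ge> 1" "H \<ge> 1"
  shows "ln (real_of_int (C * H ^ d)) \<le> (ln (real_of_int C) + d) * (1 + ln (real_of_int H))"
proof -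
  have "ln (real_of_int (C * H ^ d)) = ln (real_of_int C) + d * ln (real_of_int H)"
    using assms by (simp add: ln_mult ln_realpow)
  moreover have "ln (real_of_int C) * ln (real_of_int H) \<ge> 0" using assms by simp
  ultimately show ?thesis by (simp add: algebra_simps)
qed

text \<open>The common multiplier cancels, so the cleared numerators are integer coordinates of
  \<open>[f \<omega> : g \<omega>]\<close>. They grow polynomially in \<open>H\<close>, hence the
  logarithmic height grows at most linearly in \<open>log_height\<close>.\<close>

lemma controlled_ratio_height:
  assumes "controlled f" "controlled g"
  shows "\<exists>c \<ge> 0. \<forall>\<omega>. g \<omega> \<noteq> 0 \<longrightarrow>
    ln (proj_height (vector [f \<omega> / g \<omega>, 1] :: rat ^ 2)) \<le> c * (1 + log_height \<omega>)"
proof -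
  obtain N C C' d where *: "cleared N C d f" "cleared N C' d g"
    using controlled_common[OF assms] by blast
  have N: "N \<ge> 1" "C \<ge> 1" "C' \<ge> 1" using * by (auto simp: cleared_def)
  define M where "M = max C C'"
  have M: "M \<ge> 1" using N by (simp add: M_def)
  have "ln (proj_height (vector [f \<omega> / g \<omega>, 1] :: rat ^ 2)) \<le> (ln (real_of_int M) + d) * (1 + log_height \<omega>)"
    if g: "g \<omega> \<noteq> 0" for \<omega>
  proof -
    obtain w\<^sub>0 w H where w: "w\<^sub>0 \<noteq> 0" "\<And>i. \<omega> $ i = rat_of_int (w i) / rat_of_int w\<^sub>0" "\<bar>w\<^sub>0\<bar> \<le> H"
      "\<And>i. \<bar>w i\<bar> \<le> H" "affine_height \<omega> = real_of_int H" "H \<ge> 1"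
      by (rule affine_height_coords[of \<omega>]) blast
    obtain u where u: "rat_of_int (N * w\<^sub>0 ^ d) * f \<omega> = rat_of_int u" "\<bar>u\<bar> \<le> C * H ^ d"
      by (rule clearedD[OF *(1) w(1-4)])
    obtain v where v: "rat_of_int (N * w\<^sub>0 ^ d) * g \<omega> = rat_of_int v" "\<bar>v\<bar> \<le> C' * H ^ d"
      by (rule clearedD[OF *(2) w(1-4)])
    have nz: "rat_of_int (N * w\<^sub>0 ^ d) \<noteq> 0" using N w(1) by simp
    have "v \<noteq> 0" using v(1) nz g by auto
    moreover have "f \<omega> / g \<omega> = rat_of_int u / rat_of_int v"
      unfolding u(1)[symmetric] v(1)[symmetric] by (rule mult_divide_mult_cancel_left[OF nz, symmetric])
    moreover have "C * H ^ d \<le> M * H ^ d" "C' * H ^ d \<le> M * H ^ d"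
      using w(6) by (auto simp: M_def intro!: mult_right_mono)
    then have "\<bar>u\<bar> \<le> M * H ^ d" "\<bar>v\<bar> \<le> M * H ^ d" using u v by linarith+
    ultimately have "ln (proj_height (vector [f \<omega> / g \<omega>, 1] :: rat ^ 2)) \<le> ln (real_of_int (M * H ^ d))"
      by (rule ln_proj_height_ratio_le)
    also have "\<dots> \<le> (ln (real_of_int M) + d) * (1 + ln (real_of_int H))"
      by (rule ln_growth_le[OF M w(6)])
    finally show ?thesis unfolding log_height_def w(5) .
  qed
  moreover have "ln (real_of_int M) + d \<ge> 0" using M by simp
  ultimately show ?thesis by blast
qed

text \<open>Both coefficients are put over the denominator \<open>N * w\<^sub>0 ^ d\<close>; all
  three integers are at most \<open>M * H ^ d\<close>, so the doubling constant is linear in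
  \<open>ln H\<close>.\<close>

lemma canonical_height_special_curve_le:
  fixes E :: "('n::{finite, linorder}, int) mpoly weierstrass"
  shows "\<exists>c \<ge> 0. \<forall>\<omega>. \<forall>p \<in> curve_points (special_curve E \<omega>).
    canonical_height (special_curve E \<omega>) p \<le> x_height p + c * (1 + log_height \<omega>)"
proof -
  define f where "f = eval_mpoly (rat_mpoly (coeff_a E))"
  define g where "g = eval_mpoly (rat_mpoly (coeff_b E))"
  obtain N C C' d where *: "cleared N C d f" "cleared N C' d g"
    using controlled_common[OF controlled_eval_mpoly controlled_eval_mpoly] unfolding f_def g_def by blast
  have N: "N \<ge> 1" "C \<ge> 1" "C' \<ge> 1" using * by (auto simp: cleared_def)
  define M where "M = max N (max C C')"
  have M: "M \<ge> 1" using N by (simp add: M_def)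
  \<comment> \<open>Chosen so that \<open>c * (1 + log_height \<omega>)\<close> dominates
    \<open>L = ln 12 + 2 * ln (M * H ^ d)\<close>. The factor 1/3 from telescoping is given away
    through \<open>L / 3 \<le> L\<close>.\<close>
  define c where "c = ln 12 + 2 * (ln (real_of_int M) + d)"
  have c: "c \<ge> 0" using M by (simp add: c_def)
  have "canonical_height (special_curve E \<omega>) p \<le> x_height p + c * (1 + log_height \<omega>)"
    if p: "p \<in> curve_points (special_curve E \<omega>)" for \<omega> p
  proof -
    obtain w\<^sub>0 w H where w: "w\<^sub>0 \<noteq> 0" "\<And>i. \<omega> $ i = rat_of_int (w i) / rat_of_int w\<^sub>0" "\<bar>w\<^sub>0\<bar> \<le> H"
      "\<And>i. \<bar>w i\<bar> \<le> H" "affine_height \<omega> = real_of_int H" "H \<ge> 1"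
      by (rule affine_height_coords[of \<omega>]) blast
    obtain u where u: "rat_of_int (N * w\<^sub>0 ^ d) * f \<omega> = rat_of_int u" "\<bar>u\<bar> \<le> C * H ^ d"
      by (rule clearedD[OF *(1) w(1-4)])
    obtain v where v: "rat_of_int (N * w\<^sub>0 ^ d) * g \<omega> = rat_of_int v" "\<bar>v\<bar> \<le> C' * H ^ d"
      by (rule clearedD[OF *(2) w(1-4)])
    define D where "D = N * w\<^sub>0 ^ d"
    have D: "D \<noteq> 0" unfolding D_def using N w(1) by simp
    have "\<bar>w\<^sub>0 ^ d\<bar> \<le> H ^ d" unfolding power_abs by (rule power_mono) (use w in auto)
    then have "\<bar>D\<bar> \<le> N * H ^ d" unfolding D_def using N by (intro abs_mult_le_mult) auto
    moreover have "N * H ^ d \<le> M * H ^ d" "C * H ^ d \<le> M * H ^ d" "C' * H ^ d \<le> M * H ^ d"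
      using w(6) by (auto simp: M_def intro!: mult_right_mono)
    ultimately have le: "\<bar>D\<bar> \<le> M * H ^ d" "\<bar>u\<bar> \<le> M * H ^ d" "\<bar>v\<bar> \<le> M * H ^ d"
      using u v by linarith+
    have coeffs: "coeff_a (special_curve E \<omega>) = rat_of_int u / rat_of_int D"
      "coeff_b (special_curve E \<omega>) = rat_of_int v / rat_of_int D"
      using D unfolding u(1)[symmetric] v(1)[symmetric]
      by (simp_all add: D_def special_curve_def weierstrass.map_sel f_def g_def)
    define L where "L = ln (12 * real_of_int (M * H ^ d) ^ 2)"
    have MH: "M * H ^ d \<ge> 1" using le(1) D by linarith
    then have "real_of_int (M * H ^ d) ^ 2 \<ge> 1" using one_le_power[of "real_of_int (M * H ^ d)" 2] by linarith
    then have "L \<ge> 0" unfolding L_def by simp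
    then have "canonical_height (special_curve E \<omega>) p \<le> x_height p + L / 3"
      unfolding L_def
      by (intro canonical_height_le p x_height_double_le[OF _ D coeffs le]) auto
    moreover have "L = ln 12 + 2 * ln (real_of_int (M * H ^ d))"
    proof -
      have "ln (12 * x ^ 2) = ln 12 + 2 * ln x" if "x > 0" for x :: real
        using that by (simp add: ln_mult ln_realpow)
      moreover have "real_of_int (M * H ^ d) > 0" using MH by linarith
      ultimately show ?thesis unfolding L_def by blast
    qed
    moreover have "ln (real_of_int (M * H ^ d)) \<le> (ln (real_of_int M) + d) * (1 + log_height \<omega>)"
      unfolding log_height_def w(5) by (rule ln_growth_le[OF M w(6)])
    moreover have "ln 12 * (1 + log_height \<omega>) \<ge> ln 12 * 1"
      using log_height_nonneg[of \<omega>] by (intro mult_left_mono) auto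
    moreover have "c * (1 + log_height \<omega>) =
        ln 12 * (1 + log_height \<omega>) + 2 * ((ln (real_of_int M) + d) * (1 + log_height \<omega>))"
      by (simp add: c_def algebra_simps)
    ultimately show ?thesis using \<open>L \<ge> 0\<close> by linarith
  qed
  then show ?thesis using c by blast
qed

subsection \<open>Specialization\<close>

text \<open>Cross-multiplied identities between polynomials survive evaluation. If \<open>Z\<close>
  vanished at \<open>\<omega>\<close> but \<open>Z'\<close> did not, they would force
  \<open>X\<close> and \<open>Y\<close> to vanish there as well, which admissible coordinates
  exclude.\<close>

lemma specializes_to_unique:
  assumes "specializes_to P \<omega> p" "specializes_to P \<omega> p'"
  shows "p = p'"
proof (cases P)
  case Infinity
  then show ?thesis using assms by (auto simp: specializes_to_def homogeneous_coords_def)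
next
  case (Affine x y)
  obtain X Y Z where 1: "homogeneous_coords P X Y Z"
    "eval_mpoly X \<omega> \<noteq> 0 \<or> eval_mpoly Y \<omega> \<noteq> 0 \<or> eval_mpoly Z \<omega> \<noteq> 0"
    "p = (if eval_mpoly Z \<omega> = 0 then Infinity
             else Affine (eval_mpoly X \<omega> / eval_mpoly Z \<omega>) (eval_mpoly Y \<omega> / eval_mpoly Z \<omega>))"
    using assms(1) unfolding specializes_to_def by blast
  obtain X' Y' Z' where 2: "homogeneous_coords P X' Y' Z'"
    "eval_mpoly X' \<omega> \<noteq> 0 \<or> eval_mpoly Y' \<omega> \<noteq> 0 \<or> eval_mpoly Z' \<omega> \<noteq> 0"
    "p' = (if eval_mpoly Z' \<omega> = 0 then Infinity
             else Affine (eval_mpoly X' \<omega> / eval_mpoly Z' \<omega>) (eval_mpoly Y' \<omega> / eval_mpoly Z' \<omega>))"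
    using assms(2) unfolding specializes_to_def by blast
  have nz: "Z \<noteq> 0" "Z' \<noteq> 0" and eqs: "to_fract X / to_fract Z = to_fract X' / to_fract Z'"
    "to_fract Y / to_fract Z = to_fract Y' / to_fract Z'"
    using 1(1) 2(1) unfolding homogeneous_coords_def Affine by auto
  have "to_fract (X * Z') = to_fract (X' * Z)" "to_fract (Y * Z') = to_fract (Y' * Z)"
    using eqs nz by (simp_all add: frac_eq_eq)
  then have "X * Z' = X' * Z" "Y * Z' = Y' * Z" by (simp_all only: to_fract_eq_iff)
  then have "eval_mpoly X \<omega> * eval_mpoly Z' \<omega> = eval_mpoly X' \<omega> * eval_mpoly Z \<omega>"
    "eval_mpoly Y \<omega> * eval_mpoly Z' \<omega> = eval_mpoly Y' \<omega> * eval_mpoly Z \<omega>"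
    by (metis eval_mpoly_mult)+
  then show ?thesis using 1(2,3) 2(2,3) by (auto simp: frac_eq_eq)
qed

lemma specializes_to_specialize:
  assumes "specialization_defined P \<omega>"
  shows "specializes_to P \<omega> (specialize P \<omega>)"
proof -
  have "\<exists>!p. specializes_to P \<omega> p"
    using assms specializes_to_unique unfolding specialization_defined_def by blast
  then show ?thesis unfolding specialize_def by (rule theI')
qed

text \<open>The homogeneous cubic equation holds between polynomials, hence between their values;
  dividing by the cube of the value of \<open>Z\<close> returns to the affine equation.\<close>

lemma specializes_to_curve:
  assumes P: "P \<in> curve_points (generic_curve E)" and p: "specializes_to P \<omega> p"
  shows "p \<in> curve_points (special_curve E \<omega>)"
proof (cases "p = Infinity")
  case True
  then show ?thesis by (simp add: curve_points_def)
next
  case False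
  obtain X Y Z where XYZ: "homogeneous_coords P X Y Z"
    "p = (if eval_mpoly Z \<omega> = 0 then Infinity
             else Affine (eval_mpoly X \<omega> / eval_mpoly Z \<omega>) (eval_mpoly Y \<omega> / eval_mpoly Z \<omega>))"
    using p unfolding specializes_to_def by blast
  have Z: "eval_mpoly Z \<omega> \<noteq> 0"
    and p: "p = Affine (eval_mpoly X \<omega> / eval_mpoly Z \<omega>) (eval_mpoly Y \<omega> / eval_mpoly Z \<omega>)"
    using XYZ(2) False by (auto split: if_splits)
  have "P \<noteq> Infinity" using XYZ(1) Z by (auto simp: homogeneous_coords_def)
  then obtain x y where xy: "P = Affine x y" by (cases P) auto
  have Z0: "to_fract Z \<noteq> 0" and xy': "x = to_fract X / to_fract Z" "y = to_fract Y / to_fract Z"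
    using XYZ(1) unfolding xy homogeneous_coords_def by auto
  define A where "A = rat_mpoly (coeff_a E)"
  define B where "B = rat_mpoly (coeff_b E)"
  have "y ^ 2 = x ^ 3 + to_fract A * x + to_fract B"
    using P unfolding xy A_def B_def
    by (auto simp: curve_points_def generic_curve_def weierstrass.map_sel)
  then have "to_fract Y * to_fract Y * to_fract Z = to_fract X * to_fract X * to_fract X
      + to_fract A * to_fract X * (to_fract Z * to_fract Z) + to_fract B * (to_fract Z * to_fract Z * to_fract Z)"
    using Z0 unfolding xy' by (simp add: field_simps power2_eq_square power3_eq_cube)
  then have "to_fract (Y * Y * Z) = to_fract (X * X * X + A * X * (Z * Z) + B * (Z * Z * Z))"
    by simp
  then have "Y * Y * Z = X * X * X + A * X * (Z * Z) + B * (Z * Z * Z)"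
    by (simp only: to_fract_eq_iff)
  then have "eval_mpoly (Y * Y * Z) \<omega> = eval_mpoly (X * X * X + A * X * (Z * Z) + B * (Z * Z * Z)) \<omega>"
    by simp
  then have "(eval_mpoly Y \<omega> / eval_mpoly Z \<omega>) ^ 2 = (eval_mpoly X \<omega> / eval_mpoly Z \<omega>) ^ 3
      + eval_mpoly A \<omega> * (eval_mpoly X \<omega> / eval_mpoly Z \<omega>) + eval_mpoly B \<omega>"
    using Z by (simp add: field_simps power2_eq_square power3_eq_cube)
  then show ?thesis
    unfolding p A_def B_def by (simp add: curve_points_def special_curve_def weierstrass.map_sel)
qed

section \<open>Quotients of lowest coefficients\<close>

lemma coeff_mult_lowest:
  fixes p q :: "'a::comm_semiring_0 poly"
  assumes "\<And>i. i < k \<Longrightarrow> coeff p i = 0"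
  shows "coeff (p * q) k = coeff p k * coeff q 0"
proof -
  have "coeff (p * q) k = (\<Sum>i\<in>{k}. coeff p i * coeff q (k - i))"
    unfolding coeff_mult using assms by (intro sum.mono_neutral_right) auto
  then show ?thesis by simp
qed

text \<open>The quotients \<open>x / z\<close> and \<open>x' / z'\<close> agree, and the second is
  regular at 0; its value there is therefore the quotient of the coefficients of \<open>x\<close>
  and \<open>z\<close> at the order of vanishing of \<open>z\<close>.\<close>

lemma coeff_ratio_at_order:
  fixes x z x' z' :: "'a::idom poly"
  assumes eq: "x * z' = x' * z" and z': "coeff z' 0 \<noteq> 0" and z: "\<And>i. i < k \<Longrightarrow> coeff z i = 0"
  shows "coeff x k * coeff z' 0 = coeff x' 0 * coeff z k"
proof -
  have step: "coeff x j * coeff z' 0 = coeff x' 0 * coeff z j" if "j \<le> k" "\<And>i. i < j \<Longrightarrow> coeff x i = 0" for j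
    using coeff_mult_lowest[of j x z'] coeff_mult_lowest[of j z x'] that z eq
    by (simp add: mult.commute)
  \<comment> \<open>\<open>x\<close> vanishes at least to order \<open>k\<close> too: otherwise its
    lowest coefficient times the nonzero \<open>coeff z' 0\<close> would be a multiple of a
    vanishing coefficient of \<open>z\<close>.\<close>
  have "coeff x j = 0" if "j < k" for j
    using that
  proof (induction j rule: less_induct)
    case (less j)
    then have "coeff x j * coeff z' 0 = coeff x' 0 * coeff z j" by (intro step) auto
    then show ?case using z[OF less.prems] z' by simp
  qed
  then show ?thesis using step[of k] by simp
qed

text \<open>
  Fixed homogeneous coordinates \<open>X\<close>, \<open>Z\<close> of \<open>P\<close> may both vanish at \<open>\<omega>\<close> although \<open>P\<close> can be
  specialized there. On the line from \<open>\<omega>\<close> to a fixed point outside \<open>Z = 0\<close> they become polynomials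
  in one variable, and the \<open>x\<close>-coordinate of \<open>P\<^sub>\<omega>\<close> is the quotient of their coefficients at the
  order of vanishing of \<open>Z\<close>. This order is bounded, so finitely many quotients suffice.
\<close>

lemma x_height_specialization_le:
  fixes P :: "'n::{finite, linorder} ratfun point"
  shows "\<exists>c \<ge> 0. \<forall>\<omega> p. specializes_to P \<omega> p \<longrightarrow> x_height p \<le> c * (1 + log_height \<omega>)"
proof (cases P)
  case Infinity
  then have "x_height p = 0" if "specializes_to P \<omega> p" for \<omega> p
    using that by (auto simp: specializes_to_def homogeneous_coords_def)
  then show ?thesis by (intro exI[of _ 0]) auto
next
  case (Affine x y)
  obtain X Z where XZ: "Z \<noteq> 0" "x = to_fract X / to_fract Z"
    by (cases x) (auto simp: Fract_conv_to_fract)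
  \<comment> \<open>One \<open>\<omega>\<^sub>0\<close> outside the zero set of \<open>Z\<close>
    serves all \<open>\<omega>\<close>: every line through it has a nonzero restriction of
    \<open>Z\<close>.\<close>
  obtain \<omega>\<^sub>0 where \<omega>\<^sub>0: "eval_mpoly Z \<omega>\<^sub>0 \<noteq> 0" using exists_eval_mpoly_nonzero[OF XZ(1)] by blast
  obtain d where d: "\<And>\<omega>. degree (restrict_line Z \<omega>\<^sub>0 \<omega>) \<le> d"
    using degree_restrict_line_le by blast
  define f where "f k \<omega> = coeff (restrict_line X \<omega>\<^sub>0 \<omega>) k" for k \<omega>
  define g where "g k \<omega> = coeff (restrict_line Z \<omega>\<^sub>0 \<omega>) k" for k \<omega>
  have "\<exists>c \<ge> 0. \<forall>\<omega>. g k \<omega> \<noteq> 0 \<longrightarrow>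
    ln (proj_height (vector [f k \<omega> / g k \<omega>, 1] :: rat ^ 2)) \<le> c * (1 + log_height \<omega>)" for k
    unfolding f_def g_def by (intro controlled_ratio_height controlled_coeff_restrict_line)
  then obtain c where c: "\<And>k. c k \<ge> 0"
    "\<And>k \<omega>. g k \<omega> \<noteq> 0 \<Longrightarrow>
       ln (proj_height (vector [f k \<omega> / g k \<omega>, 1] :: rat ^ 2)) \<le> c k * (1 + log_height \<omega>)"
    by metis
  \<comment> \<open>Being nonnegative, the \<open>c k\<close> are all bounded by their sum over the
    possible orders of vanishing.\<close>
  define c' where "c' = (\<Sum>k\<le>d. c k)"
  have c': "c' \<ge> 0" unfolding c'_def using c(1) by (intro sum_nonneg)
  have "x_height p \<le> c' * (1 + log_height \<omega>)" if p: "specializes_to P \<omega> p" for \<omega> p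
  proof -
    obtain X' Y' Z' where XYZ: "homogeneous_coords P X' Y' Z'"
      "p = (if eval_mpoly Z' \<omega> = 0 then Infinity
             else Affine (eval_mpoly X' \<omega> / eval_mpoly Z' \<omega>) (eval_mpoly Y' \<omega> / eval_mpoly Z' \<omega>))"
      using p unfolding specializes_to_def by blast
    show ?thesis
    proof (cases "eval_mpoly Z' \<omega> = 0")
      case True
      then show ?thesis using XYZ(2) c' log_height_nonneg[of \<omega>] by simp
    next
      case False
      have "Z' \<noteq> 0" "x = to_fract X' / to_fract Z'"
        using XYZ(1) unfolding Affine homogeneous_coords_def by auto
      then have "to_fract (X * Z') = to_fract (X' * Z)"
        using XZ by (simp add: frac_eq_eq)
      then have "X * Z' = X' * Z" by (simp only: to_fract_eq_iff)
      then have eq: "restrict_line X \<omega>\<^sub>0 \<omega> * restrict_line Z' \<omega>\<^sub>0 \<omega> = restrict_line X' \<omega>\<^sub>0 \<omega> * restrict_line Z \<omega>\<^sub>0 \<omega>"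
        by (metis restrict_line_mult)
      \<comment> \<open>\<open>k\<close> is the order of vanishing of \<open>Z\<close> at
        \<open>\<omega>\<close> along the line; it exists because the leading coefficient of the
        restriction is nonzero.\<close>
      define k where "k = (LEAST k. g k \<omega> \<noteq> 0)"
      have "restrict_line Z \<omega>\<^sub>0 \<omega> \<noteq> 0" by (rule restrict_line_nonzero[OF \<omega>\<^sub>0])
      then have "g (degree (restrict_line Z \<omega>\<^sub>0 \<omega>)) \<omega> \<noteq> 0" unfolding g_def by simp
      then have "g k \<omega> \<noteq> 0" "k \<le> degree (restrict_line Z \<omega>\<^sub>0 \<omega>)"
        unfolding k_def by (rule LeastI, rule Least_le)
      then have gk: "g k \<omega> \<noteq> 0" "k \<le> d" using d[of \<omega>] by auto
      have "coeff (restrict_line Z \<omega>\<^sub>0 \<omega>) i = 0" if "i < k" for i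
        using not_less_Least[of i "\<lambda>k. g k \<omega> \<noteq> 0"] that unfolding k_def g_def by blast
      from coeff_ratio_at_order[OF eq _ this] False
      have "f k \<omega> * eval_mpoly Z' \<omega> = eval_mpoly X' \<omega> * g k \<omega>"
        unfolding f_def g_def coeff_0_restrict_line by simp
      then have "eval_mpoly X' \<omega> / eval_mpoly Z' \<omega> = f k \<omega> / g k \<omega>"
        using gk(1) False by (simp add: frac_eq_eq)
      then have "x_height p = ln (proj_height (vector [f k \<omega> / g k \<omega>, 1] :: rat ^ 2))"
        using XYZ(2) False by simp
      also have "\<dots> \<le> c k * (1 + log_height \<omega>)" by (rule c(2)[OF gk(1)])
      also have "\<dots> \<le> c' * (1 + log_height \<omega>)"
        unfolding c'_def using gk(2) c(1) log_height_nonneg[of \<omega>]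
        by (intro mult_right_mono member_le_sum) auto
      finally show ?thesis .
    qed
  qed
  then show ?thesis using c' by blast
qed

text \<open>Empty and infinite sets have cardinality 0, and the quotient is then 0 by convention;
  \<open>c \<ge> 0\<close> covers this case.\<close>

lemma average_le:
  fixes f :: "'a \<Rightarrow> real"
  assumes "\<And>x. x \<in> S \<Longrightarrow> f x \<le> c" "c \<ge> 0"
  shows "(\<Sum>x\<in>S. f x) / real (card S) \<le> c"
proof (cases "card S = 0")
  case False
  have "(\<Sum>x\<in>S. f x) \<le> real (card S) * c" using sum_bounded_above[of S f c] assms(1) by simp
  then show ?thesis using False by (simp add: divide_le_eq mult.commute)
qed (use assms(2) in simp)

theorem theorem4:
  fixes A B :: "('n::{finite, linorder}, int) mpoly"
    and E :: "('n, int) mpoly weierstrass"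
    and P :: "'n ratfun point"
  assumes E: "E = Weierstrass A B"
    and elliptic: "discriminant (generic_curve E) \<noteq> 0"
    and minimal: "\<not> (\<exists>g :: ('n, rat) mpoly. g \<notin> range const_mpoly \<and>
            to_fract (rat_mpoly A) / to_fract g ^ 4 \<in> int_polys \<and>
            to_fract (rat_mpoly B) / to_fract g ^ 6 \<in> int_polys)"
    and not_split: "\<not> split_curve (generic_curve E)"
    and P: "P \<in> curve_points (generic_curve E)"
  shows "(\<exists>U :: real. \<forall>b > 1. \<forall>\<omega> \<in> good_params E P b.
            canonical_height (special_curve E \<omega>) (specialize P \<omega>) \<le> U * (1 + log_height \<omega>)) \<and>
         Limsup at_top (\<lambda>b :: real. ereal
            ((\<Sum>\<omega> \<in> good_params E P b.
                canonical_height (special_curve E \<omega>) (specialize P \<omega>) / log_height \<omega>)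
              / real (card (good_params E P b)))) < \<infinity>"
proof -
  obtain c\<^sub>1 where c1: "c\<^sub>1 \<ge> 0" "\<And>\<omega> p. p \<in> curve_points (special_curve E \<omega>) \<Longrightarrow>
    canonical_height (special_curve E \<omega>) p \<le> x_height p + c\<^sub>1 * (1 + log_height \<omega>)"
    using canonical_height_special_curve_le[of E] by blast
  obtain c\<^sub>2 where c2: "c\<^sub>2 \<ge> 0" "\<And>\<omega> p. specializes_to P \<omega> p \<Longrightarrow> x_height p \<le> c\<^sub>2 * (1 + log_height \<omega>)"
    using x_height_specialization_le[of P] by blast
  \<comment> \<open>\<open>c\<^sub>1\<close> pays for passing from the canonical to the naive
    height, \<open>c\<^sub>2\<close> for the naive height of the specialized point.\<close>
  define U where "U = c\<^sub>1 + c\<^sub>2"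
  have U0: "U \<ge> 0" using c1(1) c2(1) by (simp add: U_def)
  have U: "canonical_height (special_curve E \<omega>) (specialize P \<omega>) \<le> U * (1 + log_height \<omega>)"
    if "\<omega> \<in> good_params E P b" for b \<omega>
  proof -
    have s: "specializes_to P \<omega> (specialize P \<omega>)"
      using that by (intro specializes_to_specialize) (simp add: good_params_def)
    then show ?thesis
      using c1(2)[OF specializes_to_curve[OF P s]] c2(2)[OF s] by (simp add: U_def distrib_right)
  qed
  \<comment> \<open>From \<open>(1 + h) / h = 1 / h + 1\<close> and
    \<open>h \<ge> ln 2\<close>.\<close>
  define V where "V = U * (1 / ln 2 + 1)"
  have "canonical_height (special_curve E \<omega>) (specialize P \<omega>) / log_height \<omega> \<le> V"
    if "\<omega> \<in> good_params E P b" for b \<omega>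
  proof -
    have "log_height \<omega> \<ge> ln 2"
      using that by (intro log_height_ge_ln_2) (simp add: good_params_def)
    moreover have "ln 2 > (0 :: real)" by simp
    ultimately have h: "log_height \<omega> > 0" "1 / log_height \<omega> \<le> 1 / ln 2"
      by (linarith, intro divide_left_mono mult_pos_pos) linarith+
    have "canonical_height (special_curve E \<omega>) (specialize P \<omega>) / log_height \<omega>
      \<le> U * (1 + log_height \<omega>) / log_height \<omega>"
      using U[OF that] h(1) by (intro divide_right_mono) auto
    also have "\<dots> = U * (1 / log_height \<omega> + 1)" using h(1) by (simp add: field_simps)
    also have "\<dots> \<le> V" unfolding V_def using U0 h(2) by (intro mult_left_mono) auto
    finally show ?thesis .
  qed
  moreover have "V \<ge> 0" unfolding V_def using U0 by simp
  ultimately have "(\<Sum>\<omega> \<in> good_params E P b.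
      canonical_height (special_curve E \<omega>) (specialize P \<omega>) / log_height \<omega>)
      / real (card (good_params E P b)) \<le> V" for b
    by (rule average_le)
  then have "Limsup at_top (\<lambda>b :: real. ereal ((\<Sum>\<omega> \<in> good_params E P b.
      canonical_height (special_curve E \<omega>) (specialize P \<omega>) / log_height \<omega>)
      / real (card (good_params E P b)))) \<le> ereal V"
    by (intro Limsup_bounded always_eventually allI) simp
  also have "\<dots> < \<infinity>" by simp
  finally show ?thesis using U by blast
qed

end
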